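(* Let $\lambda,\mu>0$, $0<a<1$, and let $M,N$ be the pair of correlated Poisson processes described in the context, with joint distribution $p_{m,n}(s,t)=\mathbf P\{M(s)=m,\,N(t)=n\}$. Put $$y=\frac{\lambda t}{a}>0,\qquad z=\frac{\lambda t-a\mu s}{a}<y,$$ and write $p_{m,n}(y,z)$ for $p_{m,n}(s,t)$ expressed through $y,z$. (i) When $a\mu s>\lambda t$, namely $z<0$, $$p_{m,n}(y,z)=\begin{cases}0 & n>m\ge0\\ Q_{n,n}(y,z) & m=n\ge0\\ Q_{m,n}(y,z)-Q_{m,n+1}(y,z) & m>n\ge0\end{cases}$$ where $$Q_{m,n}(y,z)=a\int_0^y dw\,h_n(aw)\sum_{k=n}^m\pi_{m-k}(w-z)\,\pi_k(y-w),\qquad m\ge n\ge0.$$ (ii) When $a\mu s<\lambda t$, namely $0<z<y$, $$p_{m,n}(y,z)=\begin{cases}A_{m,n}(y,z)-A_{m,n+1}(y,z)+B_{m,n}(y,z)-B_{m,n-1}(y,z) & n>m\ge0\\ A_{n,n}(y,z)-A_{n,n+1}(y,z)+B_{n,n}(y,z)+C_{n,n}(y,z) & m=n\ge0\\ A_{m,n}(y,z)-A_{m,n+1}(y,z)+C_{m,n}(y,z)-C_{m,n+1}(y,z) & m>n\ge0\end{cases}$$ where $$A_{m,n}(y,z)=a\int_0^z dw\,h_n(aw)\,\pi_m(y-z),\qquad n,m\ge0,$$ $$B_{m,n}(y,z)=a\int_0^z dw\,h_{n+1}(aw)\sum_{k=0}^{n-m}\pi_k(z-w)\,\pi_m(y-z),\qquad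 n\ge m\ge0,$$ $$C_{m,n}(y,z)=a\int_z^y dw\,h_n(aw)\sum_{k=n}^m\pi_{m-k}(w-z)\,\pi_k(y-w),\qquad m\ge n\ge1,$$ while $C_{m,0}(y,z)=0$ for all $m\ge0$. (iii) The results for $z<0$ and for $0<z<y$ connect with continuity in $z=0$, in the sense that for every $y>0$ $$p_{m,n}(y,0^-)=p_{m,n}(y,0^+),\qquad m,n\ge0 .$$
   Context: The processes: for $k=1,2,\ldots$ let $Y_k,Z_k$ be exponential random variables with rate $\lambda$ and $B_k(1)$ Bernoulli random variables with $\mathbf P\{B_k(1)=1\}=1-a$, $\mathbf P\{B_k(1)=0\}=a$, all mutually independent. Put $X_k=aY_k+B_k(1)Z_k$ (each $X_k$ is then exponential with rate $\lambda$), and $X_0=Y_0=Z_0=0$. For $n=0,1,2,\ldots$ let $$T_n=\sum_{k=0}^nX_k,\qquad S_n=\frac{\lambda}{\mu}\sum_{k=0}^nY_k .$$ $N$ and $M$ are the counting processes associated with $T_n$ and $S_n$ respectively: $N(t)=n$ iff $T_n\le t<T_{n+1}$, and $M(s)=m$ iff $S_m\le s<S_{m+1}$. Thus $N$ is Poisson of intensity $\lambda$, $M$ is Poisson of intensity $\mu$, and $p_{m,n}(s,t)=\mathbf P\{S_m\le s<S_{m+1},\,T_n\le t<T_{n+1}\}$. The change of variables is inverted by $t=ay/\lambda$, $s=(y-z)/\mu$. Notation: $\pi_n(\alpha)=\frac{\alpha^n}{n!}e^{-\alpha}$ for $\alpha\ge0$, $n=0,1,2,\ldots$, with $\pi_n(0)=\delta_{n,0}$;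 $\beta_k(n)=\binom nk a^{n-k}(1-a)^k$ for $k=0,\ldots,n$ (so $\beta_0(0)=1$); $f_0(x)=\delta(x)$ (Dirac delta) and $f_k(x)=\frac{x^{k-1}}{(k-1)!}e^{-x}$ for $x\ge0$, $f_k(x)=0$ for $x<0$, when $k\ge1$; and $$h_n(x)=\sum_{k=0}^n\beta_k(n)f_k(x),\qquad n=0,1,2,\ldots$$ Convention for the Dirac delta: $\int_0^b\delta(x)\,dx=1$ for every $b>0$ (the mass at the left endpoint $0$ is fully counted), while integrals over $[z,b]$ with $z>0$ receive no contribution from it. Explicitly, for a continuous function $\xi$ and $b>0$, $a\int_0^b h_n(aw)\xi(w)\,dw=a^n\xi(0)+a\int_0^b\sum_{k=1}^n\beta_k(n)f_k(aw)\xi(w)\,dw$, and for $0<z<b$, $a\int_z^b h_n(aw)\xi(w)\,dw=a\int_z^b\sum_{k=1}^n\beta_k(n)f_k(aw)\xi(w)\,dw$. $p_{m,n}(y,0^\pm)$ denote the one-sided limits as $z\to0^\pm$ at fixed $y$ of the expressions in (ii) and (i), respectively. *)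

theory Defs
  imports "HOL-Probability.Probability"
begin

definition X_incr ::
  "real \<Rightarrow> (nat \<Rightarrow> 'a \<Rightarrow> real) \<Rightarrow> (nat \<Rightarrow> 'a \<Rightarrow> real) \<Rightarrow> (nat \<Rightarrow> 'a \<Rightarrow> real) \<Rightarrow> nat \<Rightarrow> 'a \<Rightarrow> real"
where
  "X_incr a Y Z B k \<omega> = a * Y k \<omega> + B k \<omega> * Z k \<omega>"

definition T_arr ::
  "real \<Rightarrow> (nat \<Rightarrow> 'a \<Rightarrow> real) \<Rightarrow> (nat \<Rightarrow> 'a \<Rightarrow> real) \<Rightarrow> (nat \<Rightarrow> 'a \<Rightarrow> real) \<Rightarrow> nat \<Rightarrow> 'a \<Rightarrow> real"
where
  "T_arr a Y Z B n \<omega> = (\<Sum>k=0..n. X_incr a Y Z B k \<omega>)"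

definition S_arr :: "real \<Rightarrow> real \<Rightarrow> (nat \<Rightarrow> 'a \<Rightarrow> real) \<Rightarrow> nat \<Rightarrow> 'a \<Rightarrow> real"
where
  "S_arr lam mu Y n \<omega> = lam / mu * (\<Sum>k=0..n. Y k \<omega>)"

(* The index n with T n <= t < T (n + 1) exists and is unique when T is nondecreasing and
   unbounded (see counting_eq_iff), hence almost surely for the arrival times used here.
   LEAST, unlike THE, keeps the process measurable on the exceptional null set. *)
definition counting :: "(nat \<Rightarrow> 'a \<Rightarrow> real) \<Rightarrow> real \<Rightarrow> 'a \<Rightarrow> nat"
where
  "counting T t \<omega> = (LEAST n. T n \<omega> \<le> t \<and> t < T (Suc n) \<omega>)"

lemma counting_eq_iff:
  assumes mono: "\<And>k. T k \<omega> \<le> T (Suc k) \<omega>"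
    and start: "T 0 \<omega> \<le> t" and unbounded: "t < T j \<omega>"
  shows "counting T t \<omega> = n \<longleftrightarrow> T n \<omega> \<le> t \<and> t < T (Suc n) \<omega>"
proof -
  let ?P = "\<lambda>n. T n \<omega> \<le> t \<and> t < T (Suc n) \<omega>"
  have le: "T i \<omega> \<le> T k \<omega>" if "i \<le> k" for i k
    using that by (rule lift_Suc_mono_le[where f = "\<lambda>k. T k \<omega>", OF mono])
  have uniq: "i = k" if "?P i" "?P k" for i k
    using that le[of "Suc i" k] le[of "Suc k" i] by (cases i k rule: linorder_cases) auto
  have ex: "\<exists>k. ?P k"
  proof (rule ccontr)
    assume "\<not> ?thesis"
    then have "T k \<omega> \<le> t" for k
      using start by (induction k) (auto simp: not_less)
    with unbounded show False
      by (meson not_less)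
  qed
  have "?P (LEAST n. ?P n)"
    using ex by (rule LeastI_ex)
  then show ?thesis
    unfolding counting_def using uniq by blast
qed

definition N_proc ::
  "real \<Rightarrow> (nat \<Rightarrow> 'a \<Rightarrow> real) \<Rightarrow> (nat \<Rightarrow> 'a \<Rightarrow> real) \<Rightarrow> (nat \<Rightarrow> 'a \<Rightarrow> real) \<Rightarrow> real \<Rightarrow> 'a \<Rightarrow> nat"
where
  "N_proc a Y Z B = counting (T_arr a Y Z B)"

definition M_proc :: "real \<Rightarrow> real \<Rightarrow> (nat \<Rightarrow> 'a \<Rightarrow> real) \<Rightarrow> real \<Rightarrow> 'a \<Rightarrow> nat"
where
  "M_proc lam mu Y = counting (S_arr lam mu Y)"

definition pois :: "nat \<Rightarrow> real \<Rightarrow> real"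
where
  "pois n \<alpha> = \<alpha> ^ n / fact n * exp (- \<alpha>)"

definition binw :: "real \<Rightarrow> nat \<Rightarrow> nat \<Rightarrow> real"
where
  "binw a k n = real (n choose k) * a ^ (n - k) * (1 - a) ^ k"

(* Only used for k >= 1; the Dirac delta f_0 is accounted for in h_integral. *)
definition gam :: "nat \<Rightarrow> real \<Rightarrow> real"
where
  "gam k x = (if x < 0 then 0 else x ^ (k - 1) / fact (k - 1) * exp (- x))"

(* h_integral a n c b \<xi> stands for  a * integral of h_n(a w) \<xi>(w) dw over [c, b], 0 <= c < b,
   where h_n = sum_{k=0..n} binw a k n * f_k and f_0 is the Dirac delta.  As a \<delta>(a w) = \<delta>(w),
   the k = 0 term contributes binw a 0 n * \<xi> 0 = a^n * \<xi> 0 if c = 0 (an atom at the left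
   endpoint counts fully) and nothing if c > 0. *)
definition h_integral :: "real \<Rightarrow> nat \<Rightarrow> real \<Rightarrow> real \<Rightarrow> (real \<Rightarrow> real) \<Rightarrow> real"
where
  "h_integral a n c b \<xi> =
     (if c = 0 then binw a 0 n * \<xi> 0 else 0)
     + a * (LBINT w:{c..b}. (\<Sum>k=1..n. binw a k n * gam k (a * w)) * \<xi> w)"

definition Q_fun :: "real \<Rightarrow> nat \<Rightarrow> nat \<Rightarrow> real \<Rightarrow> real \<Rightarrow> real"
where
  "Q_fun a m n y z = h_integral a n 0 y (\<lambda>w. \<Sum>k=n..m. pois (m - k) (w - z) * pois k (y - w))"

definition A_fun :: "real \<Rightarrow> nat \<Rightarrow> nat \<Rightarrow> real \<Rightarrow> real \<Rightarrow> real"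
where
  "A_fun a m n y z = h_integral a n 0 z (\<lambda>w. pois m (y - z))"

definition B_fun :: "real \<Rightarrow> nat \<Rightarrow> nat \<Rightarrow> real \<Rightarrow> real \<Rightarrow> real"
where
  "B_fun a m n y z =
     h_integral a (n + 1) 0 z (\<lambda>w. \<Sum>k=0..n - m. pois k (z - w) * pois m (y - z))"

definition C_fun :: "real \<Rightarrow> nat \<Rightarrow> nat \<Rightarrow> real \<Rightarrow> real \<Rightarrow> real"
where
  "C_fun a m n y z =
     (if n = 0 then 0
      else h_integral a n z y (\<lambda>w. \<Sum>k=n..m. pois (m - k) (w - z) * pois k (y - w)))"

definition p_neg :: "real \<Rightarrow> nat \<Rightarrow> nat \<Rightarrow> real \<Rightarrow> real \<Rightarrow> real"
where
  "p_neg a m n y z =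
     (if n > m then 0
      else if m = n then Q_fun a n n y z
      else Q_fun a m n y z - Q_fun a m (n + 1) y z)"

definition p_pos :: "real \<Rightarrow> nat \<Rightarrow> nat \<Rightarrow> real \<Rightarrow> real \<Rightarrow> real"
where
  "p_pos a m n y z =
     (if n > m then
        A_fun a m n y z - A_fun a m (n + 1) y z + B_fun a m n y z - B_fun a m (n - 1) y z
      else if m = n then
        A_fun a n n y z - A_fun a n (n + 1) y z + B_fun a n n y z + C_fun a n n y z
      else
        A_fun a m n y z - A_fun a m (n + 1) y z + C_fun a m n y z - C_fun a m (n + 1) y z)"

end

theory Submission
  imports Defs
begin

text \<open>Rescale so that \<open>\<mu> S\<^sub>n = U\<^sub>n\<close> is a sum of \<open>n\<close> independent standard exponentials and
  \<open>\<lambda> T\<^sub>n = a (U\<^sub>n + W\<^sub>n)\<close>, where \<open>W\<close> is independent of \<open>U\<close>.  Then \<open>S\<^sub>m \<le> s\<close> reads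
  \<open>U\<^sub>m \<le> y - z\<close> and \<open>T\<^sub>n \<le> t\<close> reads \<open>U\<^sub>n + W\<^sub>n \<le> y\<close>.  Conditioning on the first exponential gives
  a closed form for the probability of \<open>U\<^sub>n \<le> x\<close>, \<open>U\<^sub>m \<le> y - z < U\<^bsub>m+1\<^esub>\<close>; conditioning on which
  Bernoulli variables equal 1 shows that \<open>W\<^sub>n\<close> has law \<open>a h\<^sub>n(a w) dw\<close>, so integrating the closed
  form at \<open>x = y - w\<close> gives the probability of \<open>M(s) = m\<close>, \<open>N(t) \<ge> n\<close>, and \<open>p\<^bsub>m,n\<^esub>\<close> is a difference
  of two of these.  The integrand changes its form at \<open>w = z\<close>, where the integral is split if \<open>z > 0\<close>.
  Both one-sided limits in (iii) equal the probability at \<open>z = 0\<close>, because \<open>U\<^sub>m\<close> almost surely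
  differs from \<open>y\<close>.\<close>

section \<open>Independence: reindexing a family, conditioning on one of two independent
  variables\<close>

text \<open>Injectivity of \<open>f\<close> makes the singletons \<open>{f j}\<close> disjoint, so
  grouping by them preserves independence. Evaluating each block at its only index recovers the
  variable.\<close>

lemma (in prob_space) indep_vars_reindex:
  assumes "indep_vars N X (f ` I)" and "inj_on f I"
  shows "indep_vars (\<lambda>i. N (f i)) (\<lambda>i. X (f i)) I"
proof -
  have "indep_vars (\<lambda>j. PiM {f j} N) (\<lambda>j \<omega>. \<lambda>i\<in>{f j}. X i \<omega>) I"
    using assms by (intro indep_vars_restrict[OF assms(1)]) (auto simp: disjoint_family_on_def inj_on_def)
  then have "indep_vars (\<lambda>i. N (f i)) (\<lambda>j \<omega>. (\<lambda>i\<in>{f j}. X i \<omega>) (f j)) I"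
    by (rule indep_vars_compose2[where Y = "\<lambda>j v. v (f j)"]) simp
  then show ?thesis by simp
qed

text \<open>The constant \<open>indep_var\<close> relates variables of equal type only, so the real variable is written \<open>\<phi> \<circ> U\<close>.\<close>

lemma (in prob_space) indep_prob_section:
  fixes U V :: "'a \<Rightarrow> 'b" and \<phi> :: "'b \<Rightarrow> real" and R :: "real \<Rightarrow> 'b \<Rightarrow> bool"
  assumes ind: "indep_var N1 U N V"
    and phi[measurable]: "\<phi> \<in> borel_measurable N1"
    and dist: "distributed M lborel (\<lambda>\<omega>. \<phi> (U \<omega>)) f"
    and fm: "f \<in> borel_measurable borel" and f0: "\<And>x. 0 \<le> f x"
    and R[measurable]: "Measurable.pred (borel \<Otimes>\<^sub>M N) (\<lambda>p. R (fst p) (snd p))"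
  shows "has_bochner_integral lborel (\<lambda>x. f x * \<P>(\<omega> in M. R x (V \<omega>)))
    \<P>(\<omega> in M. R (\<phi> (U \<omega>)) (V \<omega>))"
proof (rule has_bochner_integral_nn_integral)
  note fm[measurable]
  have U[measurable]: "U \<in> measurable M N1" and V[measurable]: "V \<in> measurable M N"
    using ind by (auto simp: indep_var_distribution_eq)
  interpret V: prob_space "distr M N V" by (rule prob_space_distr) simp
  define S where "S = {p \<in> space (N1 \<Otimes>\<^sub>M N). R (\<phi> (fst p)) (snd p)}"
  have S: "S \<in> sets (N1 \<Otimes>\<^sub>M N)"
  proof -
    have "(\<lambda>p. (\<phi> (fst p), snd p)) \<in> N1 \<Otimes>\<^sub>M N \<rightarrow>\<^sub>M borel \<Otimes>\<^sub>M N"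
      by measurable
    from measurable_compose[OF this R] show ?thesis
      unfolding S_def by (intro predE) simp
  qed
  \<comment> \<open>The set \<open>S\<close> lives over the space of \<open>U\<close> and serves the
    Fubini computation. \<open>S2\<close> lives over the real line: its sections show that the
    probability of \<open>R x (V \<omega>)\<close> is a measurable function of every real x.\<close>
  define S2 where "S2 = {p \<in> space (borel \<Otimes>\<^sub>M N). R (fst p) (snd p)}"
  have S2: "S2 \<in> sets (borel \<Otimes>\<^sub>M N)"
    unfolding S2_def by measurable
  have S': "S \<in> sets (distr M N1 U \<Otimes>\<^sub>M distr M N V)" using S by simp
  have sec: "emeasure (distr M N V) (Pair u -` S) = ennreal \<P>(\<omega> in M. R (\<phi> u) (V \<omega>))"
    if "u \<in> space N1" for u
  proof -
    have "emeasure (distr M N V) (Pair u -` S) = emeasure M (V -` (Pair u -` S) \<inter> space M)"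
      using S by (intro emeasure_distr sets_Pair1) auto
    also have "V -` (Pair u -` S) \<inter> space M = {\<omega>\<in>space M. R (\<phi> u) (V \<omega>)}"
      using measurable_space[OF V] that by (auto simp: S_def space_pair_measure)
    finally show ?thesis by (simp add: emeasure_eq_measure)
  qed
  have sec2: "emeasure (distr M N V) (Pair x -` S2) = ennreal \<P>(\<omega> in M. R x (V \<omega>))" for x
  proof -
    have "emeasure (distr M N V) (Pair x -` S2) = emeasure M (V -` (Pair x -` S2) \<inter> space M)"
      using S2 by (intro emeasure_distr sets_Pair1) auto
    also have "V -` (Pair x -` S2) \<inter> space M = {\<omega>\<in>space M. R x (V \<omega>)}"
      using measurable_space[OF V] by (auto simp: S2_def space_pair_measure)
    finally show ?thesis by (simp add: emeasure_eq_measure)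
  qed
  have "(\<lambda>x. emeasure (distr M N V) (Pair x -` S2)) \<in> borel_measurable borel"
    by (rule V.measurable_emeasure_Pair) (use S2 in simp)
  then have m: "(\<lambda>x. ennreal \<P>(\<omega> in M. R x (V \<omega>))) \<in> borel_measurable borel"
    unfolding sec2 .
  then have "(\<lambda>x. enn2real (ennreal \<P>(\<omega> in M. R x (V \<omega>)))) \<in> borel_measurable borel"
    by (rule measurable_compose) simp
  then have m'[measurable]: "(\<lambda>x. \<P>(\<omega> in M. R x (V \<omega>))) \<in> borel_measurable borel"
    by simp
  show "(\<lambda>x. f x * \<P>(\<omega> in M. R x (V \<omega>))) \<in> borel_measurable lborel" by simp
  show "AE x in lborel. 0 \<le> f x * \<P>(\<omega> in M. R x (V \<omega>))" using f0 by simp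
  have "emeasure M {\<omega>\<in>space M. R (\<phi> (U \<omega>)) (V \<omega>)} = emeasure (distr M (N1 \<Otimes>\<^sub>M N) (\<lambda>\<omega>. (U \<omega>, V \<omega>))) S"
    using S measurable_space[OF V] measurable_space[OF U]
    by (subst emeasure_distr) (auto simp: S_def space_pair_measure intro!: arg_cong2[where f=emeasure])
  also have "\<dots> = emeasure (distr M N1 U \<Otimes>\<^sub>M distr M N V) S"
    using ind by (auto simp: indep_var_distribution_eq)
  also have "\<dots> = (\<integral>\<^sup>+u. emeasure (distr M N V) (Pair u -` S) \<partial>distr M N1 U)"
    using S' by (rule V.emeasure_pair_measure_alt)
  also have "\<dots> = (\<integral>\<^sup>+u. ennreal \<P>(\<omega> in M. R (\<phi> u) (V \<omega>)) \<partial>distr M N1 U)"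
    by (intro nn_integral_cong sec) simp
  also have "\<dots> = (\<integral>\<^sup>+\<omega>'. ennreal \<P>(\<omega> in M. R (\<phi> (U \<omega>')) (V \<omega>)) \<partial>M)"
    by (rule nn_integral_distr) (use measurable_compose[OF phi m] in auto)
  also have "\<dots> = (\<integral>\<^sup>+x. ennreal \<P>(\<omega> in M. R x (V \<omega>)) \<partial>distr M lborel (\<lambda>\<omega>. \<phi> (U \<omega>)))"
    by (rule nn_integral_distr[symmetric]) (use m in auto)
  also have "\<dots> = (\<integral>\<^sup>+x. ennreal (f x) * ennreal \<P>(\<omega> in M. R x (V \<omega>)) \<partial>lborel)"
    unfolding distributed_distr_eq_density[OF dist] by (rule nn_integral_density) simp_all
  also have "\<dots> = (\<integral>\<^sup>+x. ennreal (f x * \<P>(\<omega> in M. R x (V \<omega>))) \<partial>lborel)"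
    by (simp add: ennreal_mult' f0)
  finally show "(\<integral>\<^sup>+x. ennreal (f x * \<P>(\<omega> in M. R x (V \<omega>))) \<partial>lborel)
      = ennreal \<P>(\<omega> in M. R (\<phi> (U \<omega>)) (V \<omega>))"
    by (simp add: emeasure_eq_measure)
qed simp

section \<open>Integrals of Poisson weights against the exponential density\<close>

text \<open>The two exponentials multiply to the constant \<open>exp (- v)\<close>, so only a power
  of \<open>v - g\<close> is integrated and the Poisson index rises by one. The cutoff
  \<open>c\<close> is 0 in the plain recursions and \<sigma> where the first exponential has to
  exceed \<sigma>.\<close>

lemma has_bochner_integral_exp_pois:
  assumes "0 \<le> c"
  shows "has_bochner_integral lborel
     (\<lambda>g. exponential_density 1 g * (if c \<le> g \<and> g \<le> v then pois k (v - g) else 0))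
     (if c \<le> v then exp (- c) * pois (Suc k) (v - c) else 0)"
proof (cases "c \<le> v")
  case True
  have "has_bochner_integral lborel (\<lambda>g. (exp (- v) * (v - g) ^ k / fact k) * indicator {c..v} g)
     ((- exp (- v) * (v - v) ^ Suc k / fact (Suc k)) - (- exp (- v) * (v - c) ^ Suc k / fact (Suc k)))"
  proof (rule has_bochner_integral_FTC_Icc_real[OF True])
    fix g
    have "((\<lambda>g. (v - g) ^ Suc k) has_real_derivative (1 + real k) * (- 1 * (v - g) ^ k)) (at g)"
      by (rule DERIV_power_Suc) (auto intro!: derivative_eq_intros)
    from DERIV_cmult[OF this, of "- exp (- v) / fact (Suc k)"]
    show "((\<lambda>g. - exp (- v) * (v - g) ^ Suc k / fact (Suc k)) has_real_derivative
        exp (- v) * (v - g) ^ k / fact k) (at g)"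
      by (simp add: add_eq_0_iff divide_simps)
  qed (auto intro!: continuous_intros)
  also have "(\<lambda>g. (exp (- v) * (v - g) ^ k / fact k) * indicator {c..v} g)
      = (\<lambda>g. exponential_density 1 g * (if c \<le> g \<and> g \<le> v then pois k (v - g) else 0))"
    using assms by (auto simp: fun_eq_iff exponential_density_def pois_def indicator_def
        mult_exp_exp algebra_simps)
  finally have "has_bochner_integral lborel
     (\<lambda>g. exponential_density 1 g * (if c \<le> g \<and> g \<le> v then pois k (v - g) else 0))
     (exp (- v) * (v - c) ^ Suc k / fact (Suc k))"
    by (simp del: fact_Suc)
  moreover have "exp (- v) * (v - c) ^ Suc k / fact (Suc k) = exp (- c) * pois (Suc k) (v - c)"
  proof -
    have "exp (- v) = exp (- c) * exp (- (v - c))" by (simp add: mult_exp_exp)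
    then show ?thesis by (simp add: pois_def del: fact_Suc power_Suc)
  qed
  ultimately show ?thesis using True by simp
next
  case False
  then have *: "(c \<le> g \<and> g \<le> v) = False" for g by auto
  show ?thesis unfolding * using False by (simp add: has_bochner_integral_zero)
qed

lemma has_bochner_integral_exp_one:
  assumes "0 \<le> c"
  shows "has_bochner_integral lborel
     (\<lambda>g. exponential_density 1 g * (if c \<le> g \<and> g \<le> v then 1 else 0))
     (if c \<le> v then exp (- c) * (1 - pois 0 (v - c)) else 0)"
proof (cases "c \<le> v")
  case True
  have "has_bochner_integral lborel (\<lambda>g. exp (- g) * indicator {c..v} g) ((- exp (- v)) - (- exp (- c)))"
    by (rule has_bochner_integral_FTC_Icc_real[OF True])
       (auto intro!: derivative_eq_intros continuous_intros)
  also have "(\<lambda>g. exp (- g) * indicator {c..v} g)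
      = (\<lambda>g. exponential_density 1 g * (if c \<le> g \<and> g \<le> v then 1 else 0))"
    using assms by (auto simp: fun_eq_iff exponential_density_def indicator_def)
  finally show ?thesis
    using True by (simp add: pois_def mult_exp_exp algebra_simps)
next
  case False
  then have *: "(c \<le> g \<and> g \<le> v) = False" for g by auto
  show ?thesis unfolding * using False by (simp add: has_bochner_integral_zero)
qed

text \<open>\<open>tail_val n x\<close> is the probability that \<open>n\<close> independent standard exponentials have sum
  at most \<open>x\<close>.  With \<open>U\<^sub>k\<close> the \<open>k\<close>-th partial sum of such variables, \<open>joint_val n m x \<sigma>\<close> is the
  probability of \<open>U\<^sub>n \<le> x\<close> and \<open>U\<^sub>m \<le> \<sigma> < U\<^bsub>m+1\<^esub>\<close>; when \<open>\<sigma> \<le> x\<close> and \<open>n \<le> m\<close> the second event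
  implies the first, which the truncated \<open>n - m\<close> accounts for.\<close>

definition tail_val :: "nat \<Rightarrow> real \<Rightarrow> real" where
  "tail_val n x = (if x < 0 then 0 else 1 - (\<Sum>k<n. pois k x))"

definition joint_val :: "nat \<Rightarrow> nat \<Rightarrow> real \<Rightarrow> real \<Rightarrow> real" where
  "joint_val n m x \<sigma> =
     (if x < 0 \<or> \<sigma> < 0 then 0
      else if \<sigma> \<le> x then pois m \<sigma> * (1 - (\<Sum>k<n - m. pois k (x - \<sigma>)))
      else (\<Sum>k=n..m. pois (m - k) (\<sigma> - x) * pois k x))"

lemma pois_0_left: "pois 0 x = exp (- x)" and pois_0_right: "pois k 0 = (if k = 0 then 1 else 0)"
  by (auto simp: pois_def)

text \<open>The binomial theorem, taken from the power series of exp: a sum of independent Poisson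
  variables is Poisson. No sign of u or v is assumed.\<close>

lemma sum_pois_convolution: "(\<Sum>k=0..m. pois (m - k) u * pois k v) = pois m (u + v)"
proof -
  have "(u + v) ^ m / fact m = (\<Sum>k\<le>m. v ^ k / fact k * (u ^ (m - k) / fact (m - k)))"
    using exp_series_add_commuting[of v u m] by (simp add: divide_inverse ac_simps)
  then have "pois m (u + v) = (\<Sum>k\<le>m. v ^ k / fact k * (u ^ (m - k) / fact (m - k))) * exp (- (u + v))"
    by (simp add: pois_def)
  also have "exp (- (u + v)) = exp (- u) * exp (- v)"
    by (simp add: mult_exp_exp)
  finally show ?thesis
    by (simp add: pois_def sum_distrib_left sum_distrib_right atMost_atLeast0 mult_ac)
qed

text \<open>With \<open>n = 0\<close> the first event only asks \<open>0 \<le> x\<close>, which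
  leaves the Poisson law of the count at \<sigma>. In the branch \<open>x < \<sigma>\<close> the sum
  is a full convolution.\<close>

lemma joint_val_0: "joint_val 0 m x \<sigma> = (if x < 0 \<or> \<sigma> < 0 then 0 else pois m \<sigma>)"
  using sum_pois_convolution[of m "\<sigma> - x" x] by (simp add: joint_val_def)

text \<open>The constant 1 contributes the weight of index 0 and each weight of index k becomes one
  of index \<open>Suc k\<close>, so n weights turn into n + 1. For \<open>c = 0\<close> this is
  conditioning on the first of n + 1 exponentials; in general the first one must be at least c, and
  \<open>exp (- c)\<close> expresses its lack of memory.\<close>

lemma tail_val_rec:
  assumes "0 \<le> c"
  shows "has_bochner_integral lborel (\<lambda>g. exponential_density 1 g * (if c \<le> g then tail_val n (v - g) else 0))
     (exp (- c) * tail_val (Suc n) (v - c))"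
proof -
  have "has_bochner_integral lborel
     (\<lambda>g. exponential_density 1 g * (if c \<le> g \<and> g \<le> v then 1 else 0) -
          (\<Sum>k<n. exponential_density 1 g * (if c \<le> g \<and> g \<le> v then pois k (v - g) else 0)))
     ((if c \<le> v then exp (- c) * (1 - pois 0 (v - c)) else 0) -
      (\<Sum>k<n. if c \<le> v then exp (- c) * pois (Suc k) (v - c) else 0))"
    by (intro has_bochner_integral_diff has_bochner_integral_sum
        has_bochner_integral_exp_pois has_bochner_integral_exp_one assms)
  also have "(\<lambda>g. exponential_density 1 g * (if c \<le> g \<and> g \<le> v then 1 else 0) -
          (\<Sum>k<n. exponential_density 1 g * (if c \<le> g \<and> g \<le> v then pois k (v - g) else 0)))
     = (\<lambda>g. exponential_density 1 g * (if c \<le> g then tail_val n (v - g) else 0))"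
    by (auto simp: fun_eq_iff tail_val_def sum_distrib_left right_diff_distrib)
  also have "((if c \<le> v then exp (- c) * (1 - pois 0 (v - c)) else 0) -
      (\<Sum>k<n. if c \<le> v then exp (- c) * pois (Suc k) (v - c) else 0)) = exp (- c) * tail_val (Suc n) (v - c)"
    by (simp add: tail_val_def sum.lessThan_Suc_shift sum_distrib_left algebra_simps del: sum.lessThan_Suc)
  finally show ?thesis .
qed

text \<open>Subtracting g from both thresholds keeps their difference, hence also their order. In
  either order the factors depending on the difference alone leave the integral, and single Poisson
  weights remain to be integrated.\<close>

lemma joint_val_rec:
  "has_bochner_integral lborel (\<lambda>g. exponential_density 1 g * joint_val n m (x - g) (\<sigma> - g))
     (joint_val (Suc n) (Suc m) x \<sigma>)"
proof (cases "\<sigma> \<le> x")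
  case True
  define C where "C = 1 - (\<Sum>k<n - m. pois k (x - \<sigma>))"
  have "has_bochner_integral lborel
     (\<lambda>g. exponential_density 1 g * (if 0 \<le> g \<and> g \<le> \<sigma> then pois m (\<sigma> - g) else 0) * C)
     ((if 0 \<le> \<sigma> then exp (- 0) * pois (Suc m) (\<sigma> - 0) else 0) * C)"
    by (intro has_bochner_integral_mult_left has_bochner_integral_exp_pois) simp
  also have "(\<lambda>g. exponential_density 1 g * (if 0 \<le> g \<and> g \<le> \<sigma> then pois m (\<sigma> - g) else 0) * C)
     = (\<lambda>g. exponential_density 1 g * joint_val n m (x - g) (\<sigma> - g))"
    using True by (auto simp: fun_eq_iff joint_val_def C_def exponential_density_def)
  also have "((if 0 \<le> \<sigma> then exp (- 0) * pois (Suc m) (\<sigma> - 0) else 0) * C) = joint_val (Suc n) (Suc m) x \<sigma>"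
    using True by (auto simp: joint_val_def C_def)
  finally show ?thesis .
next
  case False
  have "has_bochner_integral lborel
     (\<lambda>g. \<Sum>k=n..m. pois (m - k) (\<sigma> - x) *
        (exponential_density 1 g * (if 0 \<le> g \<and> g \<le> x then pois k (x - g) else 0)))
     (\<Sum>k=n..m. pois (m - k) (\<sigma> - x) * (if 0 \<le> x then exp (- 0) * pois (Suc k) (x - 0) else 0))"
    by (intro has_bochner_integral_sum has_bochner_integral_mult_right has_bochner_integral_exp_pois) simp
  also have "(\<lambda>g. \<Sum>k=n..m. pois (m - k) (\<sigma> - x) *
        (exponential_density 1 g * (if 0 \<le> g \<and> g \<le> x then pois k (x - g) else 0)))
     = (\<lambda>g. exponential_density 1 g * joint_val n m (x - g) (\<sigma> - g))"
    using False by (auto simp: fun_eq_iff joint_val_def exponential_density_def sum_distrib_left mult_ac)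
  also have "(\<Sum>k=n..m. pois (m - k) (\<sigma> - x) * (if 0 \<le> x then exp (- 0) * pois (Suc k) (x - 0) else 0))
     = joint_val (Suc n) (Suc m) x \<sigma>"
    using False by (auto simp: joint_val_def sum.shift_bounds_cl_Suc_ivl simp del: sum.cl_ivl_Suc)
  finally show ?thesis .
qed

section \<open>Partial sums of independent standard exponentials\<close>

locale exp_seq = prob_space M for M :: "'a measure" +
  fixes G :: "nat \<Rightarrow> 'a \<Rightarrow> real"
  assumes indG: "indep_vars (\<lambda>_. borel) G UNIV"
    and expG: "\<And>i. distributed M lborel (G i) (exponential_density 1)"
begin

lemma G_measurable[measurable]: "G i \<in> borel_measurable M"
  using distributed_measurable[OF expG] by simp

text \<open>The inductions below generalise over \<open>G\<close> and apply their hypothesis to this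
  sequence, which is what remains once the first exponential is fixed.\<close>

lemma shift: "exp_seq M (\<lambda>i. G (Suc i))"
proof unfold_locales
  show "indep_vars (\<lambda>_. borel) (\<lambda>i. G (Suc i)) UNIV"
    by (rule indep_vars_reindex[of "\<lambda>_. borel" G Suc]) (auto intro: indep_vars_subset[OF indG])
qed (rule expG)

text \<open>The later variables enter as one point of a finite product space, the form in which
  independence of blocks is available. This is why the applications contain terms like
  \<open>(\<lambda>i\<in>{1..K}. G i \<omega>) (Suc i)\<close>.\<close>

lemma first_step:
  assumes R: "Measurable.pred (borel \<Otimes>\<^sub>M PiM {1..K} (\<lambda>_. borel)) (\<lambda>p. R (fst p) (snd p))"
  shows "has_bochner_integral lborel
     (\<lambda>g. exponential_density 1 g * \<P>(\<omega> in M. R g (\<lambda>i\<in>{1..K}. G i \<omega>)))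
     \<P>(\<omega> in M. R (G 0 \<omega>) (\<lambda>i\<in>{1..K}. G i \<omega>))"
proof -
  have "indep_var (PiM {0} (\<lambda>_. borel)) (\<lambda>\<omega>. \<lambda>i\<in>{0}. G i \<omega>)
      (PiM {1..K} (\<lambda>_. borel)) (\<lambda>\<omega>. \<lambda>i\<in>{1..K}. G i \<omega>)"
    by (rule indep_var_restrict[OF indG]) auto
  from indep_prob_section[OF this, of "\<lambda>u. u 0" "exponential_density 1" R] R show ?thesis
    by (simp add: expG)
qed

end

text \<open>Induction on n: conditioning on \<open>G 0\<close> and \<open>tail_val_rec\<close> with
  \<open>c = 0\<close> integrate the same function, so their values agree.\<close>

lemma prob_sum_exp_le:
  assumes "exp_seq M G"
  shows "\<P>(\<omega> in M. (\<Sum>i<n. G i \<omega>) \<le> v) = tail_val n v"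
  using assms
proof (induction n arbitrary: G v)
  case 0
  interpret exp_seq M G by fact
  show ?case by (auto simp: tail_val_def prob_space)
next
  case (Suc n)
  interpret exp_seq M G by fact
  have "has_bochner_integral lborel
      (\<lambda>g. exponential_density 1 g *
        \<P>(\<omega> in M. g + (\<Sum>i<n. (\<lambda>i\<in>{1..n}. G i \<omega>) (Suc i)) \<le> v))
      \<P>(\<omega> in M. G 0 \<omega> + (\<Sum>i<n. (\<lambda>i\<in>{1..n}. G i \<omega>) (Suc i)) \<le> v)"
    by (rule first_step) measurable
  moreover have "\<P>(\<omega> in M. g + (\<Sum>i<n. (\<lambda>i\<in>{1..n}. G i \<omega>) (Suc i)) \<le> v) = tail_val n (v - g)" for g
    using Suc.IH[OF shift, of "v - g"] by (simp add: le_diff_eq add.commute)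
  ultimately have "has_bochner_integral lborel (\<lambda>g. exponential_density 1 g * tail_val n (v - g))
      \<P>(\<omega> in M. (\<Sum>i<Suc n. G i \<omega>) \<le> v)"
    by (simp add: sum.lessThan_Suc_shift del: sum.lessThan_Suc)
  moreover have "has_bochner_integral lborel (\<lambda>g. exponential_density 1 g * tail_val n (v - g)) (tail_val (Suc n) v)"
  proof -
    have "(\<lambda>g. exponential_density 1 g * (if 0 \<le> g then tail_val n (v - g) else 0))
        = (\<lambda>g. exponential_density 1 g * tail_val n (v - g))"
      by (auto simp: fun_eq_iff exponential_density_def)
    with tail_val_rec[of 0 n v] show ?thesis by simp
  qed
  ultimately show ?case by (rule has_bochner_integral_eq)
qed

text \<open>Induction on m for arbitrary n, \<open>G\<close>, x and \<sigma>. If both indices are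
  positive, fixing \<open>G 0\<close> lowers both and \<open>joint_val_rec\<close> applies. An index
  0 cannot be lowered: for \<open>n = 0\<close> the first event is constant, and for
  \<open>m = 0\<close> the first exponential has to exceed \<sigma>, which leads to
  \<open>tail_val\<close>.\<close>

lemma prob_sum_exp_joint:
  assumes "exp_seq M G"
  shows "\<P>(\<omega> in M. (\<Sum>i<n. G i \<omega>) \<le> x \<and> (\<Sum>i<m. G i \<omega>) \<le> \<sigma> \<and> \<sigma> < (\<Sum>i<Suc m. G i \<omega>)) = joint_val n m x \<sigma>"
  using assms
proof (induction m arbitrary: n G x \<sigma>)
  case 0
  interpret exp_seq M G by fact
  show ?case
  proof (cases n)
    case [simp]: 0
    show ?thesis
    proof (cases "0 \<le> x \<and> 0 \<le> \<sigma>")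
      case True
      then show ?thesis using exponential_distributedD_gt[OF expG, of \<sigma> 0]
        by (simp add: joint_val_0 pois_0_left)
    next
      case False
      then show ?thesis by (auto simp: joint_val_0)
    qed
  next
    case [simp]: (Suc k)
    show ?thesis
    proof (cases "0 \<le> \<sigma>")
      case False
      then show ?thesis by (simp add: joint_val_def)
    next
      case True
      have "has_bochner_integral lborel
          (\<lambda>g. exponential_density 1 g *
            \<P>(\<omega> in M. \<sigma> < g \<and> g + (\<Sum>i<k. (\<lambda>i\<in>{1..k}. G i \<omega>) (Suc i)) \<le> x))
          \<P>(\<omega> in M. \<sigma> < G 0 \<omega> \<and> G 0 \<omega> + (\<Sum>i<k. (\<lambda>i\<in>{1..k}. G i \<omega>) (Suc i)) \<le> x)"
        by (rule first_step) measurable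
      moreover have "\<P>(\<omega> in M. \<sigma> < g \<and> g + (\<Sum>i<k. (\<lambda>i\<in>{1..k}. G i \<omega>) (Suc i)) \<le> x)
          = (if \<sigma> < g then tail_val k (x - g) else 0)" for g
        using prob_sum_exp_le[OF shift, of k "x - g"] by (simp add: le_diff_eq add.commute)
      ultimately have 1: "has_bochner_integral lborel
          (\<lambda>g. exponential_density 1 g * (if \<sigma> < g then tail_val k (x - g) else 0))
          \<P>(\<omega> in M. (\<Sum>i<n. G i \<omega>) \<le> x \<and> (\<Sum>i<0. G i \<omega>) \<le> \<sigma> \<and> \<sigma> < (\<Sum>i<Suc 0. G i \<omega>))"
        using True by (simp add: sum.lessThan_Suc_shift conj_commute del: sum.lessThan_Suc)
      \<comment> \<open>The event is strict at \<sigma> while \<open>tail_val_rec\<close> is not;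
        the integrands differ at most in the null set \<open>{\<sigma>}\<close>.\<close>
      have "AE g in lborel. exponential_density 1 g * (if \<sigma> \<le> g then tail_val k (x - g) else 0)
          = exponential_density 1 g * (if \<sigma> < g then tail_val k (x - g) else 0)"
        using AE_lborel_singleton[of \<sigma>] by eventually_elim auto
      moreover note tail_val_rec[OF True, of k x]
      moreover have "(\<lambda>g. exponential_density 1 g * (if \<sigma> < g then tail_val k (x - g) else 0)) \<in> borel_measurable lborel"
        using 1 by (rule borel_measurable_has_bochner_integral)
      ultimately have 2: "has_bochner_integral lborel
          (\<lambda>g. exponential_density 1 g * (if \<sigma> < g then tail_val k (x - g) else 0))
          (exp (- \<sigma>) * tail_val (Suc k) (x - \<sigma>))"
        by (subst has_bochner_integral_cong_AE[symmetric])
          (auto intro: borel_measurable_has_bochner_integral)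
      show ?thesis
        unfolding has_bochner_integral_eq[OF 1 2]
        using True by (auto simp: joint_val_def tail_val_def pois_0_left)
    qed
  qed
next
  case (Suc m)
  interpret exp_seq M G by fact
  have *: "g + s \<le> x \<longleftrightarrow> s \<le> x - g" "x < g + s \<longleftrightarrow> x - g < s" for s g x :: real
    by auto
  show ?case
  proof (cases n)
    case [simp]: 0
    have "has_bochner_integral lborel
        (\<lambda>g. exponential_density 1 g *
          \<P>(\<omega> in M. 0 \<le> x \<and> g + (\<Sum>i<m. (\<lambda>i\<in>{1..Suc m}. G i \<omega>) (Suc i)) \<le> \<sigma> \<and>
            \<sigma> < g + (\<Sum>i<Suc m. (\<lambda>i\<in>{1..Suc m}. G i \<omega>) (Suc i))))
        \<P>(\<omega> in M. 0 \<le> x \<and> G 0 \<omega> + (\<Sum>i<m. (\<lambda>i\<in>{1..Suc m}. G i \<omega>) (Suc i)) \<le> \<sigma> \<and>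
            \<sigma> < G 0 \<omega> + (\<Sum>i<Suc m. (\<lambda>i\<in>{1..Suc m}. G i \<omega>) (Suc i)))"
      by (rule first_step) measurable
    moreover have "\<P>(\<omega> in M. 0 \<le> x \<and> g + (\<Sum>i<m. (\<lambda>i\<in>{1..Suc m}. G i \<omega>) (Suc i)) \<le> \<sigma> \<and>
            \<sigma> < g + (\<Sum>i<Suc m. (\<lambda>i\<in>{1..Suc m}. G i \<omega>) (Suc i))) = joint_val 0 m x (\<sigma> - g)" for g
      using Suc.IH[OF shift, of 0 x "\<sigma> - g"] by (simp add: * del: sum.lessThan_Suc)
    ultimately have 1: "has_bochner_integral lborel
        (\<lambda>g. exponential_density 1 g * joint_val 0 m x (\<sigma> - g))
        \<P>(\<omega> in M. (\<Sum>i<n. G i \<omega>) \<le> x \<and> (\<Sum>i<Suc m. G i \<omega>) \<le> \<sigma> \<and> \<sigma> < (\<Sum>i<Suc (Suc m). G i \<omega>))"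
      unfolding sum.lessThan_Suc_shift[of _ m] sum.lessThan_Suc_shift[of _ "Suc m"]
      by (simp del: sum.lessThan_Suc)
    have "has_bochner_integral lborel
        (\<lambda>g. (if 0 \<le> x then 1 else 0) * (exponential_density 1 g * (if 0 \<le> g \<and> g \<le> \<sigma> then pois m (\<sigma> - g) else 0)))
        ((if 0 \<le> x then 1 else 0) * (if 0 \<le> \<sigma> then exp (- 0) * pois (Suc m) (\<sigma> - 0) else 0))"
      by (intro has_bochner_integral_mult_right has_bochner_integral_exp_pois) simp
    also have "(\<lambda>g. (if 0 \<le> x then 1 else 0) * (exponential_density 1 g * (if 0 \<le> g \<and> g \<le> \<sigma> then pois m (\<sigma> - g) else 0)))
        = (\<lambda>g. exponential_density 1 g * joint_val 0 m x (\<sigma> - g))"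
      by (auto simp: fun_eq_iff joint_val_0 exponential_density_def)
    finally have 2: "has_bochner_integral lborel
        (\<lambda>g. exponential_density 1 g * joint_val 0 m x (\<sigma> - g)) (joint_val n (Suc m) x \<sigma>)"
      by (auto simp: joint_val_0 split: if_splits)
    from has_bochner_integral_eq[OF 1 2] show ?thesis .
  next
    case [simp]: (Suc k)
    \<comment> \<open>The block \<open>{1..k + Suc m}\<close> is large enough for all partial sums
      in the event, whichever of n and m is larger.\<close>
    have "has_bochner_integral lborel
        (\<lambda>g. exponential_density 1 g *
          \<P>(\<omega> in M. g + (\<Sum>i<k. (\<lambda>i\<in>{1..k + Suc m}. G i \<omega>) (Suc i)) \<le> x \<and>
            g + (\<Sum>i<m. (\<lambda>i\<in>{1..k + Suc m}. G i \<omega>) (Suc i)) \<le> \<sigma> \<and>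
            \<sigma> < g + (\<Sum>i<Suc m. (\<lambda>i\<in>{1..k + Suc m}. G i \<omega>) (Suc i))))
        \<P>(\<omega> in M. G 0 \<omega> + (\<Sum>i<k. (\<lambda>i\<in>{1..k + Suc m}. G i \<omega>) (Suc i)) \<le> x \<and>
            G 0 \<omega> + (\<Sum>i<m. (\<lambda>i\<in>{1..k + Suc m}. G i \<omega>) (Suc i)) \<le> \<sigma> \<and>
            \<sigma> < G 0 \<omega> + (\<Sum>i<Suc m. (\<lambda>i\<in>{1..k + Suc m}. G i \<omega>) (Suc i)))"
      by (rule first_step) measurable
    moreover have "\<P>(\<omega> in M. g + (\<Sum>i<k. (\<lambda>i\<in>{1..k + Suc m}. G i \<omega>) (Suc i)) \<le> x \<and>
            g + (\<Sum>i<m. (\<lambda>i\<in>{1..k + Suc m}. G i \<omega>) (Suc i)) \<le> \<sigma> \<and>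
            \<sigma> < g + (\<Sum>i<Suc m. (\<lambda>i\<in>{1..k + Suc m}. G i \<omega>) (Suc i))) = joint_val k m (x - g) (\<sigma> - g)" for g
      using Suc.IH[OF shift, of k "x - g" "\<sigma> - g"] by (simp add: * del: sum.lessThan_Suc)
    ultimately have 1: "has_bochner_integral lborel
        (\<lambda>g. exponential_density 1 g * joint_val k m (x - g) (\<sigma> - g))
        \<P>(\<omega> in M. (\<Sum>i<n. G i \<omega>) \<le> x \<and> (\<Sum>i<Suc m. G i \<omega>) \<le> \<sigma> \<and> \<sigma> < (\<Sum>i<Suc (Suc m). G i \<omega>))"
      unfolding Suc sum.lessThan_Suc_shift[of _ m] sum.lessThan_Suc_shift[of _ "Suc m"] sum.lessThan_Suc_shift[of _ k]
      by (simp del: sum.lessThan_Suc)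
    show ?thesis
      using has_bochner_integral_eq[OF 1 joint_val_rec] by simp
  qed
qed

section \<open>Conditioning on the Bernoulli marks\<close>

text \<open>Subsets of equal size contribute equally. This turns a sum over sets of marked indices
  into one with the weights \<open>binw\<close>.\<close>

lemma sum_Pow_card:
  fixes f :: "nat \<Rightarrow> real"
  assumes "finite A"
  shows "(\<Sum>K\<in>Pow A. f (card K)) = (\<Sum>k=0..card A. real (card A choose k) * f k)"
proof -
  have "(\<Sum>K\<in>Pow A. f (card K)) = (\<Sum>k=0..card A. \<Sum>K\<in>{K\<in>Pow A. card K = k}. f (card K))"
    using assms by (intro sum.group[symmetric]) (auto simp: card_mono)
  also have "\<dots> = (\<Sum>k=0..card A. real (card A choose k) * f k)"
    using n_subsets[OF assms] by (intro sum.cong) (auto simp: Pow_def)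
  finally show ?thesis .
qed

text \<open>In the units of the theorem \<open>G\<^sub>i = \<lambda> Y\<^bsub>i+1\<^esub>\<close> and \<open>H\<^sub>i = (\<lambda>/a) Z\<^bsub>i+1\<^esub>\<close>, so that below
  \<open>\<mu> S\<^sub>n = U\<^sub>n\<close> and \<open>\<lambda> T\<^sub>n = a (U\<^sub>n + W\<^sub>n)\<close>.\<close>

locale correlated_seq = prob_space M for M :: "'a measure" +
  fixes G H B :: "nat \<Rightarrow> 'a \<Rightarrow> real" and a :: real
  assumes a0: "0 < a" and a1: "a < 1"
    and ind: "indep_vars (\<lambda>_. borel) (case_sum G (case_sum H B)) UNIV"
    and expG: "\<And>i. distributed M lborel (G i) (exponential_density 1)"
    and expH: "\<And>i. distributed M lborel (H i) (exponential_density a)"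
    and B1: "\<And>i. \<P>(\<omega> in M. B i \<omega> = 1) = 1 - a"
    and B0: "\<And>i. \<P>(\<omega> in M. B i \<omega> = 0) = a"
begin

sublocale G: exp_seq M G
proof unfold_locales
  show "indep_vars (\<lambda>_. borel) G UNIV"
    using indep_vars_reindex[of "\<lambda>_. borel" "case_sum G (case_sum H B)" Inl UNIV]
      indep_vars_subset[OF ind] by simp
qed (rule expG)

lemma indep_H: "indep_vars (\<lambda>_. borel) H UNIV"
  using indep_vars_reindex[of "\<lambda>_. borel" "case_sum G (case_sum H B)" "\<lambda>i. Inr (Inl i)" UNIV]
      indep_vars_subset[OF ind] by (simp add: inj_on_def)

lemma H_measurable[measurable]: "H i \<in> borel_measurable M"
  using distributed_measurable[OF expH] by simp

lemma B_measurable[measurable]: "B i \<in> borel_measurable M"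
  using ind unfolding indep_vars_def2 by (metis (no_types) UNIV_I old.sum.simps(6))

definition U :: "nat \<Rightarrow> 'a \<Rightarrow> real" where "U n \<omega> = (\<Sum>i<n. G i \<omega>)"
definition W :: "nat \<Rightarrow> 'a \<Rightarrow> real" where "W n \<omega> = (\<Sum>i<n. B i \<omega> * H i \<omega>)"

lemma U_measurable[measurable]: "U n \<in> borel_measurable M"
  and W_measurable[measurable]: "W n \<in> borel_measurable M"
  unfolding U_def[abs_def] W_def[abs_def] by measurable

lemma Inl_image_iff: "Inl x \<in> Inl ` A \<longleftrightarrow> x \<in> A" and Inr_image_iff: "Inr x \<in> Inr ` A \<longleftrightarrow> x \<in> A"
  by auto

text \<open>For nonempty \<open>K\<close> the sum of the \<open>H i\<close> is Erlang of shape
  \<open>card K\<close> and independent of \<open>G\<close>, so the closed form at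
  \<open>y - w\<close> is averaged over its density; \<open>erlang_density k\<close> has shape k +
  1, hence \<open>card K - 1\<close>. An empty \<open>K\<close> gives an atom at 0, treated in
  \<open>joint_no_marks\<close>.\<close>

lemma joint_fixed_marks:
  assumes "finite K" "K \<noteq> {}"
  shows "has_bochner_integral lborel
      (\<lambda>w. erlang_density (card K - 1) a w * joint_val n m (y - w) \<sigma>)
      \<P>(\<omega> in M. U n \<omega> + (\<Sum>i\<in>K. H i \<omega>) \<le> y \<and> U m \<omega> \<le> \<sigma> \<and> \<sigma> < U (Suc m) \<omega>)"
proof -
  note Inl_image_iff[simp] Inr_image_iff[simp]
  let ?X = "case_sum G (case_sum H B)"
  let ?A = "Inr ` Inl ` K" and ?C = "Inl ` {..<n + Suc m} :: (nat + nat + nat) set"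
  let ?S = "\<lambda>k v. \<Sum>i<k. v (Inl i :: nat + nat + nat)"
  define R where "R w v \<longleftrightarrow> w + ?S n v \<le> y \<and> ?S m v \<le> \<sigma> \<and> \<sigma> < ?S (Suc m) v" for w v
  have i1: "indep_var (PiM ?A (\<lambda>_. borel)) (\<lambda>\<omega>. \<lambda>i\<in>?A. ?X i \<omega>) (PiM ?C (\<lambda>_. borel)) (\<lambda>\<omega>. \<lambda>i\<in>?C. ?X i \<omega>)"
    by (rule indep_var_restrict[OF ind]) auto
  have i2: "(\<lambda>u. \<Sum>i\<in>K. u (Inr (Inl i)) :: real) \<in> borel_measurable (PiM ?A (\<lambda>_. borel))"
    by (intro borel_measurable_sum measurable_component_singleton) auto
  have i3: "distributed M lborel (\<lambda>\<omega>. \<Sum>i\<in>K. (\<lambda>i\<in>?A. ?X i \<omega>) (Inr (Inl i))) (erlang_density (card K - 1) a)"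
    using exponential_distributed_sum[OF assms a0 expH indep_vars_subset[OF indep_H]] by simp
  have i4: "Measurable.pred (borel \<Otimes>\<^sub>M PiM ?C (\<lambda>_. borel)) (\<lambda>p. R (fst p) (snd p))"
    unfolding R_def by measurable
  have "has_bochner_integral lborel
      (\<lambda>w. erlang_density (card K - 1) a w * \<P>(\<omega> in M. R w (\<lambda>i\<in>?C. ?X i \<omega>)))
      \<P>(\<omega> in M. R (\<Sum>i\<in>K. (\<lambda>i\<in>?A. ?X i \<omega>) (Inr (Inl i))) (\<lambda>i\<in>?C. ?X i \<omega>))"
    by (rule indep_prob_section[OF i1 i2 i3 _ _ i4]) (use a0 in auto)
  moreover have "\<P>(\<omega> in M. R w (\<lambda>i\<in>?C. ?X i \<omega>)) = joint_val n m (y - w) \<sigma>" for w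
    using prob_sum_exp_joint[OF G.exp_seq_axioms, of n "y - w" m \<sigma>]
    by (simp add: R_def le_diff_eq add.commute del: sum.lessThan_Suc)
  moreover have "\<P>(\<omega> in M. R (\<Sum>i\<in>K. (\<lambda>i\<in>?A. ?X i \<omega>) (Inr (Inl i))) (\<lambda>i\<in>?C. ?X i \<omega>))
      = \<P>(\<omega> in M. U n \<omega> + (\<Sum>i\<in>K. H i \<omega>) \<le> y \<and> U m \<omega> \<le> \<sigma> \<and> \<sigma> < U (Suc m) \<omega>)"
    by (simp add: R_def U_def add.commute del: sum.lessThan_Suc)
  ultimately show ?thesis by simp
qed

lemma joint_no_marks:
  "\<P>(\<omega> in M. U n \<omega> \<le> y \<and> U m \<omega> \<le> \<sigma> \<and> \<sigma> < U (Suc m) \<omega>) = joint_val n m y \<sigma>"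
  using prob_sum_exp_joint[OF G.exp_seq_axioms] by (simp add: U_def)

lemma AE_B: "AE \<omega> in M. B i \<omega> = 0 \<or> B i \<omega> = 1"
proof -
  have "\<P>(\<omega> in M. B i \<omega> = 0 \<or> B i \<omega> = 1) = \<P>(\<omega> in M. B i \<omega> = 0) + \<P>(\<omega> in M. B i \<omega> = 1)"
    by (subst finite_measure_Union[symmetric]) (auto intro!: arg_cong[where f=prob])
  then have "\<P>(\<omega> in M. B i \<omega> = 0 \<or> B i \<omega> = 1) = 1" by (simp add: B0 B1)
  then show ?thesis by (subst (asm) prob_Collect_eq_1) auto
qed

text \<open>The marks are independent of each other and of the event about \<open>G\<close> and
  \<open>H\<close>, so the probability factors: each index below n contributes 1 - a if it lies in
  \<open>K\<close> and a otherwise.\<close>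

lemma prob_given_marks:
  assumes "K \<subseteq> {..<n}"
  shows "\<P>(\<omega> in M. (U n \<omega> + (\<Sum>i\<in>K. H i \<omega>) \<le> y \<and> U m \<omega> \<le> \<sigma> \<and> \<sigma> < U (Suc m) \<omega>) \<and>
        (\<forall>i<n. B i \<omega> = (if i \<in> K then 1 else 0)))
    = (1 - a) ^ card K * a ^ (n - card K) *
      \<P>(\<omega> in M. U n \<omega> + (\<Sum>i\<in>K. H i \<omega>) \<le> y \<and> U m \<omega> \<le> \<sigma> \<and> \<sigma> < U (Suc m) \<omega>)"
proof -
  note Inl_image_iff[simp] Inr_image_iff[simp]
  let ?X = "case_sum G (case_sum H B)"
  \<comment> \<open>Block 0 holds all \<open>G\<close> and \<open>H\<close> variables of the event,
    block \<open>Suc i\<close> the single mark \<open>B i\<close>.\<close>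
  define C :: "nat \<Rightarrow> (nat + nat + nat) set"
    where "C j = (case j of 0 \<Rightarrow> Inl ` {..<n + Suc m} \<union> Inr ` Inl ` K | Suc i \<Rightarrow> {Inr (Inr i)})" for j
  let ?N = "\<lambda>j. PiM (C j) (\<lambda>_. borel :: real measure)"
  let ?S = "\<lambda>k v. \<Sum>i<k. v (Inl i :: nat + nat + nat)"
  define E where "E v \<longleftrightarrow> ?S n v + (\<Sum>i\<in>K. v (Inr (Inl i))) \<le> y \<and> ?S m v \<le> \<sigma> \<and> \<sigma> < ?S (Suc m) v" for v
  define A where "A j = (case j of 0 \<Rightarrow> {v\<in>space (?N 0). E v}
      | Suc i \<Rightarrow> {v\<in>space (?N (Suc i)). v (Inr (Inr i)) = (if i \<in> K then 1 else 0)})" for j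
  define F where "F j = (\<lambda>\<omega>. \<lambda>i\<in>C j. ?X i \<omega>) -` A j \<inter> space M" for j
  have C0: "C 0 = Inl ` {..<n + Suc m} \<union> Inr ` Inl ` K" and CS: "C (Suc i) = {Inr (Inr i)}" for i
    by (auto simp: C_def)
  have fK: "finite K" using assms by (rule finite_subset) simp
  have iv: "indep_vars ?N (\<lambda>j \<omega>. \<lambda>i\<in>C j. ?X i \<omega>) UNIV"
    by (rule indep_vars_restrict[OF ind]) (auto simp: disjoint_family_on_def C_def split: nat.splits)
  have "A j \<in> sets (?N j)" for j
  proof (cases j)
    case 0
    have "Measurable.pred (?N 0) E" unfolding E_def C0 by measurable
    then show ?thesis unfolding 0 A_def nat.case by (rule predE)
  next
    case (Suc i)
    have "(\<lambda>v. v (Inr (Inr i))) \<in> borel_measurable (?N (Suc i))"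
      unfolding CS by (rule measurable_component_singleton) simp
    moreover have "{if i \<in> K then 1 else 0 :: real} \<in> sets borel"
      by (intro borel_singleton sets.empty_sets)
    ultimately have "(\<lambda>v. v (Inr (Inr i))) -` {if i \<in> K then 1 else 0} \<inter> space (?N (Suc i)) \<in> sets (?N (Suc i))"
      by (rule measurable_sets)
    then
    have "{v\<in>space (?N (Suc i)). v (Inr (Inr i)) = (if i \<in> K then 1 else 0)} \<in> sets (?N (Suc i))"
      by (simp only: vimage_def Int_def conj_commute mem_Collect_eq singleton_iff)
    then show ?thesis by (simp only: Suc A_def nat.case)
  qed
  then have "prob (\<Inter>j\<in>{..n}. F j)
     = (\<Prod>j\<in>{..n}. prob (F j))"
    unfolding F_def by (intro indep_varsD[OF iv]) auto
  moreover have 0: "F 0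
     = {\<omega>\<in>space M. U n \<omega> + (\<Sum>i\<in>K. H i \<omega>) \<le> y \<and> U m \<omega> \<le> \<sigma> \<and> \<sigma> < U (Suc m) \<omega>}"
    unfolding F_def A_def E_def U_def C0 by (auto simp: space_PiM simp del: sum.lessThan_Suc)
  moreover have S: "F (Suc i)
     = {\<omega>\<in>space M. B i \<omega> = (if i \<in> K then 1 else 0)}" for i
    unfolding F_def A_def CS by (auto simp: space_PiM)
  moreover have "(\<Inter>j\<in>{..n}. F j)
     = {\<omega>\<in>space M. (U n \<omega> + (\<Sum>i\<in>K. H i \<omega>) \<le> y \<and> U m \<omega> \<le> \<sigma> \<and> \<sigma> < U (Suc m) \<omega>) \<and>
        (\<forall>i<n. B i \<omega> = (if i \<in> K then 1 else 0))}"
  proof -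
    have "\<omega> \<in> (\<Inter>j\<in>{..n}. F j) \<longleftrightarrow> (\<forall>j<Suc n. \<omega> \<in> F j)" for \<omega> by (auto simp: less_Suc_eq_le)
    then have "\<omega> \<in> (\<Inter>j\<in>{..n}. F j) \<longleftrightarrow> \<omega> \<in> F 0 \<and> (\<forall>i<n. \<omega> \<in> F (Suc i))" for \<omega>
      by (simp only: All_less_Suc2)
    then show ?thesis unfolding 0 S by blast
  qed
  moreover have "(\<Prod>j\<in>{..n}. prob (F j))
     = prob (F 0) *
       (\<Prod>i<n. prob (F (Suc i)))"
    by (rule prod.atMost_shift)
  moreover have "(\<Prod>i<n. \<P>(\<omega> in M. B i \<omega> = (if i \<in> K then 1 else 0))) = (1 - a) ^ card K * a ^ (n - card K)"
  proof -
    have "(\<Prod>i<n. \<P>(\<omega> in M. B i \<omega> = (if i \<in> K then 1 else 0))) = (\<Prod>i<n. if i \<in> K then 1 - a else a)"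
      by (intro prod.cong) (auto simp: B0 B1)
    also have "\<dots> = (1 - a) ^ card ({..<n} \<inter> K) * a ^ card ({..<n} \<inter> - K)"
      by (simp add: prod.If_cases)
    also have "{..<n} \<inter> K = K" using assms by auto
    also have "{..<n} \<inter> - K = {..<n} - K" by auto
    also have "card ({..<n} - K) = n - card K" using assms fK by (simp add: card_Diff_subset)
    finally show ?thesis .
  qed
  ultimately show ?thesis by simp
qed

text \<open>Split by the set \<open>K\<close> of marked indices, on which \<open>W n\<close> is the
  sum of the \<open>H i\<close> over \<open>K\<close>. Only the size of \<open>K\<close> matters,
  which gives binomial weights. Size 0 yields the Dirac term of \<open>h_integral\<close>, size
  \<open>k \<ge> 1\<close> the term with \<open>gam k\<close>.\<close>

lemma prob_U_W_le:
  shows "\<P>(\<omega> in M. U n \<omega> + W n \<omega> \<le> y \<and> U m \<omega> \<le> \<sigma> \<and> \<sigma> < U (Suc m) \<omega>)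
    = h_integral a n 0 y (\<lambda>w. joint_val n m (y - w) \<sigma>)"
proof -
  let ?E = "\<lambda>K \<omega>. U n \<omega> + (\<Sum>i\<in>K. H i \<omega>) \<le> y \<and> U m \<omega> \<le> \<sigma> \<and> \<sigma> < U (Suc m) \<omega>"
  define J where "J k = (if k = 0 then joint_val n m y \<sigma>
      else \<integral>w. erlang_density (k - 1) a w * joint_val n m (y - w) \<sigma> \<partial>lborel)" for k
  have J: "\<P>(\<omega> in M. ?E K \<omega>) = J (card K)" if "finite K" for K
  proof (cases "K = {}")
    case True
    then show ?thesis by (simp add: J_def joint_no_marks)
  next
    case False
    then show ?thesis
      using has_bochner_integral_integral_eq[OF joint_fixed_marks[OF that False]] that
      by (simp add: J_def)
  qed
  have int: "integrable lborel (\<lambda>w. erlang_density (k - 1) a w * joint_val n m (y - w) \<sigma>)" if "k \<noteq> 0" for k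
    using joint_fixed_marks[of "{..<k}" n m y \<sigma>] that by (auto simp: has_bochner_integral_iff lessThan_empty_iff)
  have AEB: "AE \<omega> in M. \<forall>i. B i \<omega> = 0 \<or> B i \<omega> = 1"
    unfolding AE_all_countable using AE_B by simp
  have "\<P>(\<omega> in M. U n \<omega> + W n \<omega> \<le> y \<and> U m \<omega> \<le> \<sigma> \<and> \<sigma> < U (Suc m) \<omega>)
     = (\<Sum>K\<in>Pow {..<n}. \<P>(\<omega> in M. ?E K \<omega> \<and> (\<forall>i<n. B i \<omega> = (if i \<in> K then 1 else 0))))"
  proof (rule prob_sum)
    show "AE \<omega> in M. (\<forall>K\<in>Pow {..<n}. ?E K \<omega> \<and> (\<forall>i<n. B i \<omega> = (if i \<in> K then 1 else 0)) \<longrightarrow>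
          U n \<omega> + W n \<omega> \<le> y \<and> U m \<omega> \<le> \<sigma> \<and> \<sigma> < U (Suc m) \<omega>) \<and>
        (U n \<omega> + W n \<omega> \<le> y \<and> U m \<omega> \<le> \<sigma> \<and> \<sigma> < U (Suc m) \<omega> \<longrightarrow>
          (\<exists>!K. K \<in> Pow {..<n} \<and> ?E K \<omega> \<and> (\<forall>i<n. B i \<omega> = (if i \<in> K then 1 else 0))))"
      using AEB
    proof eventually_elim
      case (elim \<omega>)
      have W_eq: "W n \<omega> = (\<Sum>i\<in>K. H i \<omega>)"
        if "K \<subseteq> {..<n}" "\<forall>i<n. B i \<omega> = (if i \<in> K then 1 else 0)" for K
      proof -
        have "W n \<omega> = (\<Sum>i<n. if i \<in> K then H i \<omega> else 0)"
          unfolding W_def using that by (intro sum.cong) auto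
        also have "\<dots> = (\<Sum>i\<in>{..<n} \<inter> K. H i \<omega>)" by (simp add: sum.inter_restrict)
        also have "{..<n} \<inter> K = K" using that by auto
        finally show ?thesis .
      qed
      \<comment> \<open>Almost surely all marks are 0 or 1. Then \<open>K0\<close> is the only set
        compatible with them, as \<open>prob_sum\<close> requires.\<close>
      define K0 where "K0 = {i. i < n \<and> B i \<omega> = 1}"
      have K0: "K0 \<subseteq> {..<n}" "\<forall>i<n. B i \<omega> = (if i \<in> K0 then 1 else 0)"
        using elim by (auto simp: K0_def)
      have uniq: "K = K0" if "K \<subseteq> {..<n}" "\<forall>i<n. B i \<omega> = (if i \<in> K then 1 else 0)" for K
        using that by (force simp: K0_def split: if_splits)
      show ?case
      proof (intro conjI ballI impI)
        fix K assume K: "K \<in> Pow {..<n}" and "?E K \<omega> \<and> (\<forall>i<n. B i \<omega> = (if i \<in> K then 1 else 0))"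
        then have E: "?E K \<omega>" and marks: "\<forall>i<n. B i \<omega> = (if i \<in> K then 1 else 0)" by blast+
        have "W n \<omega> = (\<Sum>i\<in>K. H i \<omega>)" using K marks by (intro W_eq) blast+
        with E show "U n \<omega> + W n \<omega> \<le> y" "U m \<omega> \<le> \<sigma>" "\<sigma> < U (Suc m) \<omega>" by simp_all
      next
        assume W: "U n \<omega> + W n \<omega> \<le> y \<and> U m \<omega> \<le> \<sigma> \<and> \<sigma> < U (Suc m) \<omega>"
        show "\<exists>!K. K \<in> Pow {..<n} \<and> ?E K \<omega> \<and> (\<forall>i<n. B i \<omega> = (if i \<in> K then 1 else 0))"
        proof (rule ex1I[of _ K0])
          show "K0 \<in> Pow {..<n} \<and> ?E K0 \<omega> \<and> (\<forall>i<n. B i \<omega> = (if i \<in> K0 then 1 else 0))"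
            using W W_eq[OF K0] K0 by (metis Pow_iff)
          show "K = K0" if "K \<in> Pow {..<n} \<and> ?E K \<omega> \<and> (\<forall>i<n. B i \<omega> = (if i \<in> K then 1 else 0))" for K
            using that by (intro uniq) blast+
        qed
      qed
    qed
  next
    fix K
    have "Measurable.pred M (\<lambda>\<omega>. B i \<omega> = (if i \<in> K then 1 else 0))" for i
      by (cases "i \<in> K") simp_all
    then show "{\<omega>\<in>space M. ?E K \<omega> \<and> (\<forall>i<n. B i \<omega> = (if i \<in> K then 1 else 0))} \<in> events"
      by measurable
    show "{\<omega>\<in>space M. U n \<omega> + W n \<omega> \<le> y \<and> U m \<omega> \<le> \<sigma> \<and> \<sigma> < U (Suc m) \<omega>} \<in> events"
      by measurable
  qed simp
  also have "\<dots> = (\<Sum>K\<in>Pow {..<n}. (1 - a) ^ card K * a ^ (n - card K) * J (card K))"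
    by (intro sum.cong refl, subst prob_given_marks) (auto simp: J finite_subset)
  also have "\<dots> = (\<Sum>k=0..n. binw a k n * J k)"
    using sum_Pow_card[of "{..<n}" "\<lambda>k. (1 - a) ^ k * a ^ (n - k) * J k"]
    by (simp add: binw_def mult_ac)
  also have "\<dots> = binw a 0 n * joint_val n m y \<sigma> + (\<Sum>k=1..n. binw a k n * J k)"
    by (subst sum.atLeast_Suc_atMost) (auto simp: J_def)
  also have "(\<Sum>k=1..n. binw a k n * J k)
     = (\<Sum>k=1..n. \<integral>w. binw a k n * (erlang_density (k - 1) a w * joint_val n m (y - w) \<sigma>) \<partial>lborel)"
    by (intro sum.cong) (auto simp: J_def)
  also have "\<dots> = (\<integral>w. (\<Sum>k=1..n. binw a k n * (erlang_density (k - 1) a w * joint_val n m (y - w) \<sigma>)) \<partial>lborel)"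
    by (intro Bochner_Integration.integral_sum[symmetric] integrable_mult_right int) auto
  \<comment> \<open>The Erlang density of rate a is \<open>gam\<close> rescaled by a. Restricting to
    \<open>{0..y}\<close> loses nothing, since \<open>gam\<close> vanishes to the left of 0 and
    \<open>joint_val\<close> vanishes for \<open>w > y\<close>.\<close>
  also have "\<dots> = (\<integral>w. a * (indicator {0..y} w * ((\<Sum>k=1..n. binw a k n * gam k (a * w)) * joint_val n m (y - w) \<sigma>)) \<partial>lborel)"
  proof (intro Bochner_Integration.integral_cong refl)
    fix w
    have e: "erlang_density (k - 1) a w = a * gam k (a * w)" if "k \<in> {1..n}" for k
      using that a0 by (cases k) (auto simp: erlang_density_def gam_def power_mult_distrib mult_less_0_iff)
    have z: "joint_val n m (y - w) \<sigma> = 0" if "y < w" using that by (simp add: joint_val_def)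
    have g: "gam k (a * w) = 0" if "w < 0" for k using that a0 by (simp add: gam_def mult_less_0_iff)
    have "(\<Sum>k=1..n. binw a k n * (erlang_density (k - 1) a w * joint_val n m (y - w) \<sigma>))
       = a * ((\<Sum>k=1..n. binw a k n * gam k (a * w)) * joint_val n m (y - w) \<sigma>)"
      unfolding sum_distrib_left sum_distrib_right by (intro sum.cong refl) (subst e; simp add: mult_ac)
    also have "\<dots> = a * (indicator {0..y} w * ((\<Sum>k=1..n. binw a k n * gam k (a * w)) * joint_val n m (y - w) \<sigma>))"
      by (cases "w < 0"; cases "y < w"; simp add: z g indicator_def)
    finally show "(\<Sum>k=1..n. binw a k n * (erlang_density (k - 1) a w * joint_val n m (y - w) \<sigma>)) = \<dots>" .
  qed
  also have "\<dots> = a * (LBINT w:{0..y}. (\<Sum>k=1..n. binw a k n * gam k (a * w)) * joint_val n m (y - w) \<sigma>)"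
    by (simp add: set_lebesgue_integral_def)
  finally show ?thesis by (simp add: h_integral_def)
qed

end

section \<open>Evaluating the integrals of the closed form as Q, A, B and C\<close>

text \<open>The hypothesis \<open>c \<le> b\<close> puts 0 into \<open>{c..b}\<close> when
  \<open>c = 0\<close>, so that the atom sees equal values too.\<close>

lemma h_integral_cong:
  assumes "\<And>w. w \<in> {c..b} \<Longrightarrow> \<xi> w = \<xi>' w" and "c \<le> b"
  shows "h_integral a n c b \<xi> = h_integral a n c b \<xi>'"
  using assms unfolding h_integral_def
  by (auto intro!: arg_cong2[where f="(+)"] set_lebesgue_integral_cong)

lemma continuous_on_h_density:
  assumes "0 \<le> c" "0 \<le> a"
  shows "continuous_on {c..b} (\<lambda>w. \<Sum>k=1..n. binw a k n * gam k (a * w))"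
proof (intro continuous_on_sum continuous_on_mult continuous_on_const)
  fix k
  have "continuous_on {c..b} (\<lambda>w. (a * w) ^ (k - 1) / fact (k - 1) * exp (- (a * w)))"
    by (intro continuous_intros) auto
  moreover have "0 \<le> a * w" if "w \<in> {c..b}" for w
    using that assms by (auto intro: mult_nonneg_nonneg)
  ultimately show "continuous_on {c..b} (\<lambda>w. gam k (a * w))"
    by (subst continuous_on_cong[OF refl]) (auto simp: gam_def not_less[symmetric])
qed

lemma set_integrable_h_density:
  assumes "0 \<le> c" "0 \<le> a" "continuous_on {c..b} \<xi>"
  shows "set_integrable lborel {c..b} (\<lambda>w. (\<Sum>k=1..n. binw a k n * gam k (a * w)) * \<xi> w)"
  by (intro borel_integrable_atLeastAtMost' continuous_on_mult continuous_on_h_density assms)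

lemma h_integral_diff:
  assumes "0 \<le> c" "0 \<le> a" "continuous_on {c..b} \<xi>" "continuous_on {c..b} \<xi>'"
  shows "h_integral a n c b (\<lambda>w. \<xi> w - \<xi>' w) = h_integral a n c b \<xi> - h_integral a n c b \<xi>'"
proof -
  have "(LBINT w:{c..b}. (\<Sum>k=1..n. binw a k n * gam k (a * w)) * (\<xi> w - \<xi>' w)) =
      (LBINT w:{c..b}. (\<Sum>k=1..n. binw a k n * gam k (a * w)) * \<xi> w) -
      (LBINT w:{c..b}. (\<Sum>k=1..n. binw a k n * gam k (a * w)) * \<xi>' w)"
    unfolding right_diff_distrib using assms by (intro set_integral_diff(2) set_integrable_h_density)
  then show ?thesis
    unfolding h_integral_def by (simp add: right_diff_distrib)
qed

text \<open>The two intervals share only the null point z, and the atom at 0 stays with the left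
  one. The integrand may be given by different continuous expressions on the two sides.\<close>

lemma h_integral_split:
  assumes "0 < z" "z \<le> b" "0 \<le> a"
    and "continuous_on {0..z} \<xi>1" "continuous_on {z..b} \<xi>2"
    and 1: "\<And>w. w \<in> {0..z} \<Longrightarrow> \<xi> w = \<xi>1 w" and 2: "\<And>w. w \<in> {z..b} \<Longrightarrow> \<xi> w = \<xi>2 w"
  shows "h_integral a n 0 b \<xi> = h_integral a n 0 z \<xi>1 + h_integral a n z b \<xi>2"
proof -
  let ?d = "\<lambda>w. \<Sum>k=1..n. binw a k n * gam k (a * w)"
  have c1: "continuous_on {0..z} \<xi>" using assms(4) 1 by (subst continuous_on_cong[OF refl]) auto
  have c2: "continuous_on {z..b} \<xi>" using assms(5) 2 by (subst continuous_on_cong[OF refl]) auto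
  have "{0..b} = {0..z} \<union> {z..b}" using assms by auto
  moreover have "AE w in lborel. \<not> (w \<in> {0..z} \<and> w \<in> {z..b})"
    using AE_lborel_singleton[of z] by eventually_elim auto
  then have "(LBINT w:{0..z} \<union> {z..b}. ?d w * \<xi> w) = (LBINT w:{0..z}. ?d w * \<xi> w) + (LBINT w:{z..b}. ?d w * \<xi> w)"
    using assms c1 c2 by (intro set_integral_Un_AE set_integrable_h_density) auto
  ultimately have "h_integral a n 0 b \<xi> = h_integral a n 0 z \<xi> + h_integral a n z b \<xi>"
    using assms by (simp add: h_integral_def algebra_simps)
  also have "h_integral a n 0 z \<xi> = h_integral a n 0 z \<xi>1" using assms 1 by (intro h_integral_cong) auto
  also have "h_integral a n z b \<xi> = h_integral a n z b \<xi>2" using assms 2 by (intro h_integral_cong) auto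
  finally show ?thesis .
qed

lemma continuous_on_pois[continuous_intros]:
  "continuous_on S f \<Longrightarrow> continuous_on S (\<lambda>w. pois k (f w))"
  unfolding pois_def by (intro continuous_intros) auto

text \<open>For \<open>z < 0\<close> and \<open>0 \<le> w\<close> one has
  \<open>y - w < y - z\<close>, so \<open>joint_val\<close> never leaves its last branch. The sum
  over k is empty if \<open>n > m\<close>.\<close>

lemma h_integral_joint_val_neg:
  assumes "z < 0" "0 < y"
  shows "h_integral a n 0 y (\<lambda>w. joint_val n m (y - w) (y - z)) = (if n \<le> m then Q_fun a m n y z else 0)"
proof -
  have "h_integral a n 0 y (\<lambda>w. joint_val n m (y - w) (y - z))
     = h_integral a n 0 y (\<lambda>w. \<Sum>k=n..m. pois (m - k) (w - z) * pois k (y - w))"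
    using assms by (intro h_integral_cong) (auto simp: joint_val_def)
  then show ?thesis by (auto simp: Q_fun_def h_integral_def)
qed

text \<open>The branch of \<open>joint_val\<close> changes at \<open>w = z\<close>. The left piece
  gives A, from which B is subtracted if \<open>n > m\<close>; the right piece gives C, or an empty
  sum if \<open>n > m\<close>. For \<open>n = 0\<close> it has neither density nor atom, in
  agreement with \<open>C_fun\<close> being 0.\<close>

lemma h_integral_joint_val_pos:
  assumes z: "0 < z" "z < y" and a: "0 \<le> a"
  shows "h_integral a n 0 y (\<lambda>w. joint_val n m (y - w) (y - z)) =
     (if n \<le> m then A_fun a m n y z + C_fun a m n y z else A_fun a m n y z - B_fun a m (n - 1) y z)"
proof -
  let ?f = "\<lambda>w. pois m (y - z) * (1 - (\<Sum>k<n - m. pois k (z - w)))"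
  let ?g = "\<lambda>w. \<Sum>k=n..m. pois (m - k) (w - z) * pois k (y - w)"
  \<comment> \<open>At \<open>w = z\<close> the definition selects the other branch; both agree
    there because the Poisson weights at 0 are Kronecker deltas.\<close>
  have g: "joint_val n m (y - w) (y - z) = ?g w" if w: "w \<in> {z..y}" for w
  proof (cases "w = z")
    case True
    have "(\<Sum>k<n - m. pois k 0) = (if n \<le> m then 0 else 1)"
      by (simp add: pois_0_right)
    moreover have "?g z = (\<Sum>k=n..m. if k = m then pois m (y - z) else 0)"
      by (intro sum.cong) (auto simp: pois_0_right)
    ultimately show ?thesis using z True by (simp add: joint_val_def)
  next
    case False
    then show ?thesis using w z by (auto simp: joint_val_def)
  qed
  have f: "joint_val n m (y - w) (y - z) = ?f w" if w: "w \<in> {0..z}" for w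
    using w z by (auto simp: joint_val_def)
  have "h_integral a n 0 y (\<lambda>w. joint_val n m (y - w) (y - z)) = h_integral a n 0 z ?f + h_integral a n z y ?g"
    using z a f g by (intro h_integral_split continuous_intros) auto
  also have "\<dots> = (if n \<le> m then A_fun a m n y z + C_fun a m n y z else A_fun a m n y z - B_fun a m (n - 1) y z)"
  proof (cases "n \<le> m")
    case True
    then show ?thesis using z by (simp add: A_fun_def C_fun_def h_integral_def)
  next
    case False
    \<comment> \<open>\<open>B_fun a m (n - 1)\<close> integrates against the density of index n,
      and its inner sum runs up to n - 1 - m.\<close>
    then have [simp]: "Suc (n - Suc 0) = n" "{..<n - m} = {0..n - 1 - m}" by auto
    have "h_integral a n 0 z ?f = h_integral a n 0 z (\<lambda>w. pois m (y - z) - (\<Sum>k=0..n - 1 - m. pois k (z - w) * pois m (y - z)))"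
      by (simp add: algebra_simps sum_distrib_left)
    also have "\<dots> = A_fun a m n y z - B_fun a m (n - 1) y z"
      using a by (subst h_integral_diff) (auto intro!: continuous_intros simp: A_fun_def B_fun_def)
    finally show ?thesis using False z by (simp add: h_integral_def)
  qed
  finally show ?thesis .
qed

section \<open>The counting processes and their joint law\<close>

text \<open>The Poisson weights sum to 1. This gives unboundedness of the arrival times in
  \<open>AE_unbounded\<close>.\<close>

lemma tail_val_tendsto_0: "(\<lambda>n. tail_val n x) \<longlonglongrightarrow> 0"
proof (cases "x < 0")
  case False
  have "(\<lambda>k. x ^ k / fact k) sums exp x"
    using exp_converges[of x] by (simp add: divide_inverse mult.commute)
  then have "(\<lambda>k. pois k x) sums (exp x * exp (- x))"
    unfolding pois_def by (rule sums_mult2)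
  then have "(\<lambda>n. \<Sum>k<n. pois k x) \<longlonglongrightarrow> 1"
    by (simp add: sums_def mult_exp_exp)
  then have "(\<lambda>n. 1 - (\<Sum>k<n. pois k x)) \<longlonglongrightarrow> 1 - 1"
    by (intro tendsto_diff tendsto_const)
  then show ?thesis using False by (simp add: tail_val_def)
qed (simp add: tail_val_def)

context correlated_seq
begin

lemma AE_G_nonneg: "AE \<omega> in M. \<forall>i. 0 \<le> G i \<omega>"
  unfolding AE_all_countable
proof
  fix i
  show "AE \<omega> in M. 0 \<le> G i \<omega>"
    using distributed_AE2[OF expG, of "\<lambda>x. 0 \<le> x" i] by (auto simp: exponential_density_def)
qed

lemma AE_H_nonneg: "AE \<omega> in M. \<forall>i. 0 \<le> H i \<omega>"
  unfolding AE_all_countable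
proof
  fix i
  show "AE \<omega> in M. 0 \<le> H i \<omega>"
    using distributed_AE2[OF expH, of "\<lambda>x. 0 \<le> x" i] by (auto simp: exponential_density_def)
qed

lemma AE_mono:
  "AE \<omega> in M. \<forall>n. U n \<omega> \<le> U (Suc n) \<omega> \<and> W n \<omega> \<le> W (Suc n) \<omega> \<and> 0 \<le> W n \<omega>"
proof -
  have "AE \<omega> in M. \<forall>i. B i \<omega> = 0 \<or> B i \<omega> = 1"
    unfolding AE_all_countable using AE_B by simp
  with AE_G_nonneg AE_H_nonneg show ?thesis
  proof eventually_elim
    case (elim \<omega>)
    then have "0 \<le> B i \<omega> * H i \<omega>" for i
      by (metis mult_nonneg_nonneg order_refl zero_le_one)
    with elim show ?case by (auto simp: U_def W_def intro!: sum_nonneg)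
  qed
qed

lemma AE_unbounded: "AE \<omega> in M. \<exists>j. x < U j \<omega>"
proof -
  let ?E = "\<lambda>j. {\<omega>\<in>space M. U j \<omega> \<le> x}"
  have "\<P>(\<omega> in M. \<forall>j. U j \<omega> \<le> x) \<le> tail_val j x" for j
  proof -
    have "\<P>(\<omega> in M. \<forall>j. U j \<omega> \<le> x) \<le> \<P>(\<omega> in M. U j \<omega> \<le> x)"
      by (rule finite_measure_mono) auto
    then show ?thesis using prob_sum_exp_le[OF G.exp_seq_axioms] by (simp add: U_def)
  qed
  then have "\<P>(\<omega> in M. \<forall>j. U j \<omega> \<le> x) \<le> 0"
    using tail_val_tendsto_0[of x] by (intro LIMSEQ_le_const) auto
  then have "\<P>(\<omega> in M. \<forall>j. U j \<omega> \<le> x) = 0"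
    by (simp add: measure_le_0_iff)
  then have "AE \<omega> in M. \<not> (\<forall>j. U j \<omega> \<le> x)"
    by (subst (asm) prob_Collect_eq_0) auto
  then show ?thesis by (simp add: not_le)
qed

text \<open>\<open>counting_eq_iff\<close> applied path by path. Since \<open>W\<close> is almost
  surely nonnegative, an index j with \<open>y < U j \<omega>\<close> also serves for
  \<open>U + W\<close>.\<close>

lemma AE_counting:
  assumes "0 \<le> \<sigma>" "0 \<le> y"
  shows "AE \<omega> in M. \<forall>m n. (counting U \<sigma> \<omega> = m \<and> counting (\<lambda>n \<omega>. U n \<omega> + W n \<omega>) y \<omega> = n) \<longleftrightarrow>
    (U m \<omega> \<le> \<sigma> \<and> \<sigma> < U (Suc m) \<omega>) \<and> (U n \<omega> + W n \<omega> \<le> y \<and> y < U (Suc n) \<omega> + W (Suc n) \<omega>)"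
  using AE_mono AE_unbounded[of \<sigma>] AE_unbounded[of y]
proof eventually_elim
  case (elim \<omega>)
  from elim obtain i j where i: "\<sigma> < U i \<omega>" and j: "y < U j \<omega>" by auto
  have 1: "counting U \<sigma> \<omega> = m \<longleftrightarrow> U m \<omega> \<le> \<sigma> \<and> \<sigma> < U (Suc m) \<omega>" for m
    using elim i assms by (intro counting_eq_iff) (auto simp: U_def)
  have 2: "counting (\<lambda>n \<omega>. U n \<omega> + W n \<omega>) y \<omega> = n \<longleftrightarrow>
      U n \<omega> + W n \<omega> \<le> y \<and> y < U (Suc n) \<omega> + W (Suc n) \<omega>" for n
    using elim j assms
    by (intro counting_eq_iff[where j=j]) (auto simp: U_def[of 0] W_def[of 0] intro: add_mono less_le_trans)
  show ?case using 1 2 by blast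
qed

lemma counting_measurable[measurable]:
  assumes [measurable]: "\<And>n. T n \<in> borel_measurable M"
  shows "counting T t \<in> measurable M (count_space UNIV)"
  unfolding counting_def[abs_def] by measurable

lemma prob_counting:
  assumes "0 \<le> \<sigma>" "0 \<le> y"
  shows "\<P>(\<omega> in M. counting U \<sigma> \<omega> = m \<and> counting (\<lambda>n \<omega>. U n \<omega> + W n \<omega>) y \<omega> = n) =
     \<P>(\<omega> in M. (U m \<omega> \<le> \<sigma> \<and> \<sigma> < U (Suc m) \<omega>) \<and> (U n \<omega> + W n \<omega> \<le> y \<and> y < U (Suc n) \<omega> + W (Suc n) \<omega>))"
  by (rule measure_eq_AE) (use AE_counting[OF assms] in auto)

text \<open>As \<open>U + W\<close> is almost surely nondecreasing, the event that the n-th arrival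
  is at most y splits into exactly n arrivals and at least n + 1.\<close>

lemma prob_counting_diff:
  "\<P>(\<omega> in M. (U m \<omega> \<le> \<sigma> \<and> \<sigma> < U (Suc m) \<omega>) \<and> (U n \<omega> + W n \<omega> \<le> y \<and> y < U (Suc n) \<omega> + W (Suc n) \<omega>)) =
    h_integral a n 0 y (\<lambda>w. joint_val n m (y - w) \<sigma>) - h_integral a (Suc n) 0 y (\<lambda>w. joint_val (Suc n) m (y - w) \<sigma>)"
proof -
  let ?E = "\<lambda>n \<omega>. U n \<omega> + W n \<omega> \<le> y \<and> U m \<omega> \<le> \<sigma> \<and> \<sigma> < U (Suc m) \<omega>"
  let ?F = "\<lambda>\<omega>. (U m \<omega> \<le> \<sigma> \<and> \<sigma> < U (Suc m) \<omega>) \<and> (U n \<omega> + W n \<omega> \<le> y \<and> y < U (Suc n) \<omega> + W (Suc n) \<omega>)"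
  have "\<P>(\<omega> in M. ?E n \<omega>) = \<P>(\<omega> in M. ?F \<omega> \<or> ?E (Suc n) \<omega>)"
  proof (rule measure_eq_AE)
    show "AE \<omega> in M. \<omega> \<in> {\<omega>\<in>space M. ?E n \<omega>} \<longleftrightarrow> \<omega> \<in> {\<omega>\<in>space M. ?F \<omega> \<or> ?E (Suc n) \<omega>}"
      using AE_mono
    proof eventually_elim
      case (elim \<omega>)
      then have "U n \<omega> + W n \<omega> \<le> U (Suc n) \<omega> + W (Suc n) \<omega>" by (intro add_mono) auto
      then show ?case by auto
    qed
  qed auto
  also have "\<dots> = \<P>(\<omega> in M. ?F \<omega>) + \<P>(\<omega> in M. ?E (Suc n) \<omega>)"
    by (subst finite_measure_Union[symmetric]) (auto intro!: arg_cong[where f=prob])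
  finally show ?thesis by (simp only: prob_U_W_le)
qed

section \<open>Continuity in \<sigma> and the one-sided limits at z = 0\<close>

lemma AE_U_neq:
  assumes "x \<noteq> 0"
  shows "AE \<omega> in M. U m \<omega> \<noteq> x"
proof (cases "m = 0")
  case True
  then show ?thesis using assms by (simp add: U_def)
next
  case False
  then have "distributed M lborel (\<lambda>\<omega>. \<Sum>i\<in>{..<m}. G i \<omega>) (erlang_density (card {..<m} - 1) 1)"
    by (intro exponential_distributed_sum expG indep_vars_subset[OF G.indG]) (auto simp: lessThan_empty_iff)
  from distributed_AE2[OF this, of "\<lambda>v. v \<noteq> x"] show ?thesis
    using AE_lborel_singleton[of x] by (auto simp: U_def)
qed

text \<open>Almost surely neither \<open>U m\<close> nor \<open>U (Suc m)\<close> equals \<sigma>0,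
  so along any sequence tending to \<sigma>0 the indicator of the event is eventually constant.
  Dominated convergence then applies.\<close>

lemma prob_U_interval_tendsto:
  assumes "\<sigma>0 \<noteq> 0" and [measurable]: "Measurable.pred M E"
  shows "((\<lambda>\<sigma>. \<P>(\<omega> in M. (U m \<omega> \<le> \<sigma> \<and> \<sigma> < U (Suc m) \<omega>) \<and> E \<omega>)) \<longlongrightarrow>
     \<P>(\<omega> in M. (U m \<omega> \<le> \<sigma>0 \<and> \<sigma>0 < U (Suc m) \<omega>) \<and> E \<omega>)) (at \<sigma>0)"
  unfolding tendsto_at_iff_sequentially
proof safe
  fix X :: "nat \<Rightarrow> real" assume X: "X \<longlonglongrightarrow> \<sigma>0"
  let ?E = "\<lambda>\<sigma>. {\<omega>\<in>space M. (U m \<omega> \<le> \<sigma> \<and> \<sigma> < U (Suc m) \<omega>) \<and> E \<omega>}"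
  have "(\<lambda>i. \<integral>\<omega>. indicator (?E (X i)) \<omega> \<partial>M) \<longlonglongrightarrow> (\<integral>\<omega>. indicator (?E \<sigma>0) \<omega> \<partial>M :: real)"
  proof (rule integral_dominated_convergence[where w = "\<lambda>_. 1"])
    show "AE \<omega> in M. (\<lambda>i. indicator (?E (X i)) \<omega> :: real) \<longlonglongrightarrow> indicator (?E \<sigma>0) \<omega>"
      using AE_U_neq[OF assms(1), of m] AE_U_neq[OF assms(1), of "Suc m"]
    proof eventually_elim
      case (elim \<omega>)
      have ev: "\<forall>\<^sub>F i in sequentially. (c \<le> X i \<longleftrightarrow> c \<le> \<sigma>0) \<and> (X i < c \<longleftrightarrow> \<sigma>0 < c)" if "c \<noteq> \<sigma>0" for c
      proof (cases "c < \<sigma>0")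
        case True
        from order_tendstoD(1)[OF X this] show ?thesis
          by eventually_elim (use True in auto)
      next
        case False
        with that have c: "\<sigma>0 < c" by simp
        from order_tendstoD(2)[OF X this] show ?thesis
          by eventually_elim (use c in auto)
      qed
      have "\<forall>\<^sub>F i in sequentially. (indicator (?E (X i)) \<omega> :: real) = indicator (?E \<sigma>0) \<omega>"
        using ev[OF elim(1)] ev[OF elim(2)] by eventually_elim (auto simp: indicator_def)
      then show ?case by (rule tendsto_eventually)
    qed
  qed auto
  then show "((\<lambda>\<sigma>. \<P>(\<omega> in M. (U m \<omega> \<le> \<sigma> \<and> \<sigma> < U (Suc m) \<omega>) \<and> E \<omega>)) \<circ> X) \<longlonglongrightarrow> prob (?E \<sigma>0)"
    by (simp add: comp_def)
qed

lemma prob_eq_p_neg: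
  assumes "z < 0" "0 < y"
  shows "\<P>(\<omega> in M. (U m \<omega> \<le> y - z \<and> y - z < U (Suc m) \<omega>) \<and> (U n \<omega> + W n \<omega> \<le> y \<and> y < U (Suc n) \<omega> + W (Suc n) \<omega>))
    = p_neg a m n y z"
  unfolding prob_counting_diff h_integral_joint_val_neg[OF assms] by (auto simp: p_neg_def)

lemma prob_eq_p_pos:
  assumes "0 < z" "z < y"
  shows "\<P>(\<omega> in M. (U m \<omega> \<le> y - z \<and> y - z < U (Suc m) \<omega>) \<and> (U n \<omega> + W n \<omega> \<le> y \<and> y < U (Suc n) \<omega> + W (Suc n) \<omega>))
    = p_pos a m n y z"
  unfolding prob_counting_diff h_integral_joint_val_pos[OF assms less_imp_le[OF a0]] by (auto simp: p_pos_def)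

text \<open>Both formulas express one probability \<open>F\<close> at \<open>y - z\<close>, on the
  two sides of \<open>z = 0\<close>. Since \<open>F\<close> is continuous at \<open>y > 0\<close>,
  the common limit is \<open>F y\<close>.\<close>

lemma p_neg_p_pos_limit:
  assumes "0 < y"
  shows "\<exists>L. ((\<lambda>z. p_neg a m n y z) \<longlongrightarrow> L) (at_left 0) \<and> ((\<lambda>z. p_pos a m n y z) \<longlongrightarrow> L) (at_right 0)"
proof -
  define F where "F \<sigma> = \<P>(\<omega> in M. (U m \<omega> \<le> \<sigma> \<and> \<sigma> < U (Suc m) \<omega>) \<and>
      (U n \<omega> + W n \<omega> \<le> y \<and> y < U (Suc n) \<omega> + W (Suc n) \<omega>))" for \<sigma>
  have "(F \<longlongrightarrow> F y) (at y)"
    unfolding F_def[abs_def] using assms by (intro prob_U_interval_tendsto) auto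
  then have "((\<lambda>z. F (y - z)) \<longlongrightarrow> F y) (at 0)"
    by (intro isCont_tendsto_compose[where g=F and l=y, simplified]) (auto simp: isCont_def intro!: tendsto_eq_intros)
  then have lim: "((\<lambda>z. F (y - z)) \<longlongrightarrow> F y) (at_left 0)" "((\<lambda>z. F (y - z)) \<longlongrightarrow> F y) (at_right 0)"
    by (simp_all add: filterlim_at_split)
  have "F (y - z) = p_neg a m n y z" if "z < 0" for z
    unfolding F_def using that assms by (rule prob_eq_p_neg)
  then have "\<forall>\<^sub>F z in at_left 0. F (y - z) = p_neg a m n y z"
    unfolding eventually_at_left_field by (auto intro!: exI[of _ "- 1"])
  moreover have "F (y - z) = p_pos a m n y z" if "0 < z" "z < y" for z
    unfolding F_def using that by (rule prob_eq_p_pos)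
  then have "\<forall>\<^sub>F z in at_right 0. F (y - z) = p_pos a m n y z"
    unfolding eventually_at_right_field using assms by (auto intro!: exI[of _ y])
  ultimately show ?thesis
    using lim by (intro exI[of _ "F y"]) (auto simp: tendsto_cong)
qed

end

section \<open>Transfer to the original processes by rescaling\<close>

theorem proposition5p3:
  fixes P :: "'a measure" and Y Z B :: "nat \<Rightarrow> 'a \<Rightarrow> real" and lam mu a :: real
  assumes "prob_space P"
    and "lam > 0" and "mu > 0" and "0 < a" and "a < 1"
    and "\<And>\<omega>. Y 0 \<omega> = 0" and "\<And>\<omega>. Z 0 \<omega> = 0"
    and "\<And>k. k \<ge> 1 \<Longrightarrow> distributed P lborel (Y k) (exponential_density lam)"
    and "\<And>k. k \<ge> 1 \<Longrightarrow> distributed P lborel (Z k) (exponential_density lam)"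
    and "\<And>k. k \<ge> 1 \<Longrightarrow> \<P>(\<omega> in P. B k \<omega> = 1) = 1 - a"
    and "\<And>k. k \<ge> 1 \<Longrightarrow> \<P>(\<omega> in P. B k \<omega> = 0) = a"
    and "prob_space.indep_vars P (\<lambda>_. borel) (case_sum Y (case_sum Z B))
           ({1..} <+> ({1..} <+> {1..}))"
  shows "(\<forall>(s::real) (t::real) y z m n.
            y = lam * t / a \<and> z = (lam * t - a * mu * s) / a \<and> 0 < y \<and> z < y \<longrightarrow>
              (a * mu * s > lam * t \<longleftrightarrow> z < 0) \<and>
              (a * mu * s > lam * t \<longrightarrow>
                 \<P>(\<omega> in P. M_proc lam mu Y s \<omega> = m \<and> N_proc a Y Z B t \<omega> = n) = p_neg a m n y z) \<and>
              (a * mu * s < lam * t \<longleftrightarrow> 0 < z \<and> z < y) \<and>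
              (a * mu * s < lam * t \<longrightarrow>
                 \<P>(\<omega> in P. M_proc lam mu Y s \<omega> = m \<and> N_proc a Y Z B t \<omega> = n) = p_pos a m n y z))
         \<and> (\<forall>y>0. \<forall>m n. \<exists>L.
              ((\<lambda>z. p_neg a m n y z) \<longlongrightarrow> L) (at_left 0) \<and>
              ((\<lambda>z. p_pos a m n y z) \<longlongrightarrow> L) (at_right 0))"
proof -
  interpret prob_space P by fact
  define G where "G i \<omega> = lam * Y (Suc i) \<omega>" for i \<omega>
  define H where "H i \<omega> = lam / a * Z (Suc i) \<omega>" for i \<omega>
  define B' where "B' i = B (Suc i)" for i
  \<comment> \<open>\<open>f\<close> raises each of the three kinds of index by one, so that its
    range avoids the degenerate index 0 and independence is available on it.\<close>
  define f :: "nat + nat + nat \<Rightarrow> nat + nat + nat" where "f = map_sum Suc (map_sum Suc Suc)"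
  let ?X = "case_sum Y (case_sum Z B)"
  interpret correlated_seq P G H B' a
  proof unfold_locales
    have "inj f"
      unfolding f_def by (intro sum.inj_map) auto
    moreover have "indep_vars (\<lambda>_. borel) ?X (range f)"
      by (rule indep_vars_subset[OF assms(12)])
        (auto simp: f_def map_sum_def split: sum.splits)
    ultimately have "indep_vars (\<lambda>_. borel) (\<lambda>i. ?X (f i)) UNIV"
      using indep_vars_reindex[of "\<lambda>_. borel" ?X f UNIV] by simp
    then have "indep_vars (\<lambda>_. borel)
        (\<lambda>i \<omega>. case_sum (\<lambda>_. lam) (case_sum (\<lambda>_. lam / a) (\<lambda>_. 1)) i * ?X (f i) \<omega>) UNIV"
      by (rule indep_vars_compose2[where Y = "\<lambda>i x. case_sum (\<lambda>_. lam) (case_sum (\<lambda>_. lam / a) (\<lambda>_. 1)) i * x"]) simp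
    also have "(\<lambda>i \<omega>. case_sum (\<lambda>_. lam) (case_sum (\<lambda>_. lam / a) (\<lambda>_. 1)) i * ?X (f i) \<omega>) = case_sum G (case_sum H B')"
      by (auto simp: fun_eq_iff G_def H_def B'_def f_def split: sum.splits)
    finally show "indep_vars (\<lambda>_. borel) (case_sum G (case_sum H B')) UNIV" .
    show "distributed P lborel (G i) (exponential_density 1)" for i
      using erlang_distributed_mult_const[OF assms(8)[of "Suc i"], of lam] assms(2)
      by (simp add: G_def[abs_def])
    show "distributed P lborel (H i) (exponential_density a)" for i
      using erlang_distributed_mult_const[OF assms(9)[of "Suc i"], of "lam / a"] assms(2,4)
      by (simp add: H_def[abs_def])
  qed (use assms in \<open>simp_all add: B'_def\<close>)
  have US: "S_arr lam mu Y n \<omega> = U n \<omega> / mu" for n \<omega>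
    using assms(6) by (simp add: S_arr_def U_def G_def sum_distrib_left[symmetric]
        atLeast0AtMost sum.atMost_shift)
  have UT: "T_arr a Y Z B n \<omega> = a / lam * (U n \<omega> + W n \<omega>)" for n \<omega>
  proof -
    \<comment> \<open>The term with index 0 vanishes whatever the value of \<open>B 0\<close>,
      because \<open>Y 0\<close> and \<open>Z 0\<close> are 0.\<close>
    have "T_arr a Y Z B n \<omega> = (\<Sum>i<n. a * Y (Suc i) \<omega> + B (Suc i) \<omega> * Z (Suc i) \<omega>)"
      using assms(6,7) by (simp add: T_arr_def X_incr_def atLeast0AtMost sum.atMost_shift)
    also have "\<dots> = a / lam * (U n \<omega> + W n \<omega>)"
      unfolding U_def W_def sum.distrib[symmetric] sum_distrib_left
      using assms(2,4) by (intro sum.cong) (auto simp: G_def H_def B'_def field_simps)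
    finally show ?thesis .
  qed
  \<comment> \<open>Rescaling by positive factors preserves every comparison inside
    \<open>counting\<close>, so the rescaled processes coincide with the original ones at every
    point, not just almost surely.\<close>
  have key: "\<P>(\<omega> in P. M_proc lam mu Y s \<omega> = m \<and> N_proc a Y Z B t \<omega> = n) =
     \<P>(\<omega> in P. (U m \<omega> \<le> y - z \<and> y - z < U (Suc m) \<omega>) \<and> (U n \<omega> + W n \<omega> \<le> y \<and> y < U (Suc n) \<omega> + W (Suc n) \<omega>))"
    if "y = lam * t / a" "z = (lam * t - a * mu * s) / a" "0 < y" "z < y" for s t y z m n
  proof -
    have yz: "y - z = mu * s" using that(1,2) assms(4) by (simp add: diff_divide_distrib)
    have "M_proc lam mu Y s = counting U (y - z)"
      unfolding M_proc_def counting_def[abs_def] US yz using assms(3) by (simp add: field_simps)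
    moreover have "N_proc a Y Z B t = counting (\<lambda>n \<omega>. U n \<omega> + W n \<omega>) y"
    proof -
      have "a / lam * x \<le> t \<longleftrightarrow> x \<le> y" "t < a / lam * x \<longleftrightarrow> y < x" for x
        using assms(2,4) by (auto simp: that(1) field_simps)
      then show ?thesis unfolding N_proc_def counting_def[abs_def] UT by simp
    qed
    ultimately show ?thesis using prob_counting[of "y - z" y m n] that by simp
  qed
  have sgn: "a * mu * s > lam * t \<longleftrightarrow> z < 0" "a * mu * s < lam * t \<longleftrightarrow> 0 < z"
    if "z = (lam * t - a * mu * s) / a" for s t z
    using that assms(4) by (auto simp: divide_less_0_iff zero_less_divide_iff)
  show ?thesis
  proof (intro conjI allI impI)
    fix s t y z :: real and m n :: nat
    assume *: "y = lam * t / a \<and> z = (lam * t - a * mu * s) / a \<and> 0 < y \<and> z < y"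
    then have yz: "y = lam * t / a" "z = (lam * t - a * mu * s) / a" "0 < y" "z < y" by blast+
    note sg = sgn[OF yz(2)]
    show "lam * t < a * mu * s \<longleftrightarrow> z < 0" by (rule sg)
    show "a * mu * s < lam * t \<longleftrightarrow> 0 < z \<and> z < y" using sg yz by blast
    show "\<P>(\<omega> in P. M_proc lam mu Y s \<omega> = m \<and> N_proc a Y Z B t \<omega> = n) = p_neg a m n y z"
      if "lam * t < a * mu * s"
      using that sg yz by (simp only: key[OF yz] prob_eq_p_neg)
    show "\<P>(\<omega> in P. M_proc lam mu Y s \<omega> = m \<and> N_proc a Y Z B t \<omega> = n) = p_pos a m n y z"
      if "a * mu * s < lam * t"
      using that sg yz by (simp only: key[OF yz] prob_eq_p_pos)
  qed (rule p_neg_p_pos_limit)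
qed

end
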